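(* Let $\mathcal{A}$ be a free ideal ring, $Q\in\mathrm{Mat}_{k\times m}(\mathcal{A})$, and let $M_0\le M$ be an extension of free $\mathcal{A}$-modules, where either $M_0=L_Q$ is the row space of $Q$ and $M\le\mathcal{A}^m$ (left modules), or $M_0=R_Q$ is the column space of $Q$ and $M\le\mathcal{A}^k$ (right modules). Then the following are equivalent: 1. $M_0\le_{\mathrm{alg}}M$. 2. $(M^{*Q})^{*Q}=M$. 3. $\mathrm{rk}(M^{*Q})=\mathrm{rk}(M)$.
   Context: A free ideal ring (FIR) is a ring $\mathcal{A}$ all of whose one-sided ideals are free as $\mathcal{A}$-modules, of well-defined rank; then every submodule of a free (left or right) $\mathcal{A}$-module is free, of well-defined rank, denoted $\mathrm{rk}$. For a free $\mathcal{A}$-module $N$ and a submodule $M\le N$: $M$ is a free factor of $N$, written $M\le_* N$, if a basis of $M$ can be extended to a basis of $N$; the extension is algebraic, written $M\le_{\mathrm{alg}}N$, if there is no free factor $L$ of $N$ with $M\le L\subsetneq N$. $\mathcal{A}^k$ is the right $\mathcal{A}$-module of column vectors of length $k$, and $\mathcal{A}^m$ the left $\mathcal{A}$-module of row vectors of length $m$. For any matrix $X$ over $\mathcal{A}$, the column space $R_X$ is the right submodule generated by its columns, and the row space $L_X$ is the left submodule generated by its rows; so $R_Q\le\mathcal{A}^k$ and $L_Q\le\mathcal{A}^m$. $Q$-dual: Let $R_Q\le M\le\mathcal{A}^k$. Choose a finitely generated free factor $M_{\mathrm{fin}}\le_* M$ containing $R_Q$ (one exists) and a basis $f_1,\dots,f_t$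 of it; let $B\in\mathrm{Mat}_{t\times m}(\mathcal{A})$ be the unique matrix with $Q=(f_1\,|\,\cdots\,|\,f_t)B$. Then $M^{*Q}:=L_B\le\mathcal{A}^m$; it does not depend on the choices and contains $L_Q$. Symmetrically, let $L_Q\le M\le\mathcal{A}^m$. Choose a finitely generated free factor $M_{\mathrm{fin}}\le_* M$ containing $L_Q$ and a basis $g_1,\dots,g_t$ of it; let $C\in\mathrm{Mat}_{k\times t}(\mathcal{A})$ be the unique matrix with $Q=CG$, where $G$ is the matrix with rows $g_1,\dots,g_t$. Then $M^{*Q}:=R_C\le\mathcal{A}^k$; it does not depend on the choices and contains $R_Q$. *)

theory Defs
  imports Complex_Main "HOL-Library.Function_Algebras"
begin

unbundle cardinal_syntax

text \<open>
  The library's module theory (\<open>Modules\<close>, \<open>HOL-Algebra.Module\<close>) needs commutative scalars, so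
  the notions below are stated for an arbitrary scalar action \<open>s\<close> of a ring on an additive
  group. They never mention the law for \<open>s (a * b)\<close>, so they apply equally to left actions and to
  right actions (where \<open>s a x\<close> stands for \<open>x a\<close>).
\<close>

definition submodule :: "('a::ring_1 \<Rightarrow> 'b::ab_group_add \<Rightarrow> 'b) \<Rightarrow> 'b set \<Rightarrow> bool" where
  "submodule s M \<longleftrightarrow> 0 \<in> M \<and> (\<forall>x\<in>M. \<forall>y\<in>M. x + y \<in> M) \<and> (\<forall>a. \<forall>x\<in>M. s a x \<in> M)"

definition mod_span :: "('a::ring_1 \<Rightarrow> 'b::ab_group_add \<Rightarrow> 'b) \<Rightarrow> 'b set \<Rightarrow> 'b set" where
  "mod_span s S = submodule s hull S"

definition mod_independent :: "('a::ring_1 \<Rightarrow> 'b::ab_group_add \<Rightarrow> 'b) \<Rightarrow> 'b set \<Rightarrow> bool" where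
  "mod_independent s B \<longleftrightarrow>
     (\<forall>T c. finite T \<and> T \<subseteq> B \<and> (\<Sum>v\<in>T. s (c v) v) = 0 \<longrightarrow> (\<forall>v\<in>T. c v = 0))"

definition is_basis :: "('a::ring_1 \<Rightarrow> 'b::ab_group_add \<Rightarrow> 'b) \<Rightarrow> 'b set \<Rightarrow> 'b set \<Rightarrow> bool" where
  "is_basis s B M \<longleftrightarrow> mod_independent s B \<and> mod_span s B = M"

definition free_of_unique_rank :: "('a::ring_1 \<Rightarrow> 'b::ab_group_add \<Rightarrow> 'b) \<Rightarrow> 'b set \<Rightarrow> bool" where
  "free_of_unique_rank s M \<longleftrightarrow>
     (\<exists>B. is_basis s B M) \<and> (\<forall>B C. is_basis s B M \<and> is_basis s C M \<longrightarrow> |B| =o |C| )"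

text \<open>
  Submodules of \<open>\<A>\<^sup>k\<close> need not be finitely generated, so the rank is a cardinal, to be compared
  with \<open>=o\<close>. It is meaningful only for free modules of unique rank.
\<close>

definition rk :: "('a::ring_1 \<Rightarrow> 'b::ab_group_add \<Rightarrow> 'b) \<Rightarrow> 'b set \<Rightarrow> 'b rel" where
  "rk s M = |SOME B. is_basis s B M|"

definition free_factor :: "('a::ring_1 \<Rightarrow> 'b::ab_group_add \<Rightarrow> 'b) \<Rightarrow> 'b set \<Rightarrow> 'b set \<Rightarrow> bool" where
  "free_factor s M N \<longleftrightarrow> (\<exists>B C. is_basis s B M \<and> B \<subseteq> C \<and> is_basis s C N)"

definition algebraic_ext :: "('a::ring_1 \<Rightarrow> 'b::ab_group_add \<Rightarrow> 'b) \<Rightarrow> 'b set \<Rightarrow> 'b set \<Rightarrow> bool" where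
  "algebraic_ext s M N \<longleftrightarrow> M \<subseteq> N \<and> \<not> (\<exists>L. free_factor s L N \<and> M \<subseteq> L \<and> L \<subset> N)"

definition free_ideal_ring :: "'a::ring_1 itself \<Rightarrow> bool" where
  "free_ideal_ring _ \<longleftrightarrow>
     (\<forall>I::'a set. submodule (\<lambda>a x. a * x) I \<longrightarrow> free_of_unique_rank (\<lambda>a x. a * x) I) \<and>
     (\<forall>I::'a set. submodule (\<lambda>a x. x * a) I \<longrightarrow> free_of_unique_rank (\<lambda>a x. x * a) I)"

text \<open>
  A vector of length \<open>n\<close> is a function on \<open>nat\<close> vanishing outside \<open>{..<n}\<close>, and a
  \<open>k \<times> m\<close> matrix \<open>X\<close> a function vanishing outside \<open>{..<k} \<times> {..<m}\<close>; thus its \<open>i\<close>-th row is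
  \<open>X i\<close> and its \<open>j\<close>-th column is \<open>\<lambda>i. X i j\<close>.
\<close>

definition vecs :: "nat \<Rightarrow> (nat \<Rightarrow> 'a::ring_1) set" where
  "vecs n = {v. \<forall>i\<ge>n. v i = 0}"

definition mats :: "nat \<Rightarrow> nat \<Rightarrow> (nat \<Rightarrow> nat \<Rightarrow> 'a::ring_1) set" where
  "mats k m = {X. \<forall>i j. k \<le> i \<or> m \<le> j \<longrightarrow> X i j = 0}"

text \<open>The product of a matrix with \<open>t\<close> columns and a matrix with \<open>t\<close> rows.\<close>

definition mat_mul ::
    "nat \<Rightarrow> (nat \<Rightarrow> nat \<Rightarrow> 'a::ring_1) \<Rightarrow> (nat \<Rightarrow> nat \<Rightarrow> 'a) \<Rightarrow> nat \<Rightarrow> nat \<Rightarrow> 'a" where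
  "mat_mul t X Y = (\<lambda>i j. \<Sum>l<t. X i l * Y l j)"

definition lscale :: "'a::ring_1 \<Rightarrow> (nat \<Rightarrow> 'a) \<Rightarrow> nat \<Rightarrow> 'a" where
  "lscale a v = (\<lambda>i. a * v i)"

definition rscale :: "'a::ring_1 \<Rightarrow> (nat \<Rightarrow> 'a) \<Rightarrow> nat \<Rightarrow> 'a" where
  "rscale a v = (\<lambda>i. v i * a)"

text \<open>\<open>k\<close> is the number of rows and \<open>m\<close> the number of columns of \<open>X\<close>.\<close>

definition row_space :: "nat \<Rightarrow> (nat \<Rightarrow> nat \<Rightarrow> 'a::ring_1) \<Rightarrow> (nat \<Rightarrow> 'a) set" where
  "row_space k X = mod_span lscale ((\<lambda>i. X i) ` {..<k})"

definition col_space :: "nat \<Rightarrow> (nat \<Rightarrow> nat \<Rightarrow> 'a::ring_1) \<Rightarrow> (nat \<Rightarrow> 'a) set" where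
  "col_space m X = mod_span rscale ((\<lambda>j i. X i j) ` {..<m})"

text \<open>
  The two halves of the \<open>Q\<close>-dual \<open>M\<^sup>*\<^sup>Q\<close>: \<open>right_dual\<close> maps a right module \<open>R\<^sub>Q \<le> M \<le> \<A>\<^sup>k\<close>
  to a left submodule of \<open>\<A>\<^sup>m\<close>, and \<open>left_dual\<close> maps a left module \<open>L\<^sub>Q \<le> M \<le> \<A>\<^sup>m\<close> to a right
  submodule of \<open>\<A>\<^sup>k\<close>. The basis of \<open>M\<^sub>f\<^sub>i\<^sub>n\<close> is a list, which makes \<open>M\<^sub>f\<^sub>i\<^sub>n\<close> finitely generated.
\<close>

definition right_dual ::
    "nat \<Rightarrow> (nat \<Rightarrow> nat \<Rightarrow> 'a::ring_1) \<Rightarrow> (nat \<Rightarrow> 'a) set \<Rightarrow> (nat \<Rightarrow> 'a) set" where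
  "right_dual m Q M = (SOME D. \<exists>Mfin fs B.
     free_factor rscale Mfin M \<and> col_space m Q \<subseteq> Mfin \<and>
     distinct fs \<and> is_basis rscale (set fs) Mfin \<and>
     B \<in> mats (length fs) m \<and> Q = mat_mul (length fs) (\<lambda>i l. (fs ! l) i) B \<and>
     D = row_space (length fs) B)"

definition left_dual ::
    "nat \<Rightarrow> (nat \<Rightarrow> nat \<Rightarrow> 'a::ring_1) \<Rightarrow> (nat \<Rightarrow> 'a) set \<Rightarrow> (nat \<Rightarrow> 'a) set" where
  "left_dual k Q M = (SOME D. \<exists>Mfin gs C.
     free_factor lscale Mfin M \<and> row_space k Q \<subseteq> Mfin \<and>
     distinct gs \<and> is_basis lscale (set gs) Mfin \<and>
     C \<in> mats k (length gs) \<and> Q = mat_mul (length gs) C (\<lambda>l. gs ! l) \<and>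
     D = col_space (length gs) C)"

end

theory Submission
  imports Defs "HOL-Library.Product_Plus"
begin

text \<open>
  The \<open>Q\<close>-dual has a description without choices. Let \<open>M\<close> contain the vectors \<open>x\<^sub>i\<close> (the rows or the
  columns of \<open>Q\<close>). Then \<open>M\<^sup>*\<^sup>Q\<close> consists of the tuples \<open>\<phi>\<^sup>Q = (\<phi> x\<^sub>i)\<^sub>i\<close>, where \<open>\<phi>\<close> runs over the linear
  forms \<open>M \<rightarrow> \<A>\<close>: if the \<open>x\<^sub>i\<close> are combinations of a basis of a free factor of \<open>M\<close>, the tuples of
  coefficients come from the coordinate forms of that basis, and these extend to \<open>M\<close>
  (\<open>span_presentation_eq_dual\<close>). In particular the dual does not change when \<open>M\<close> is replaced by a
  free factor that still contains the \<open>x\<^sub>i\<close> (\<open>dual_free_factor\<close>).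

  Let \<open>D = M\<^sup>*\<^sup>Q\<close>. A form \<open>\<psi>\<close> on \<open>D\<close> gives in the same way a vector \<open>\<psi>\<^sup>Q\<close> of the bidual, which lies in
  \<open>M\<close>, and \<open>\<phi> (\<psi>\<^sup>Q) = \<psi> (\<phi>\<^sup>Q)\<close> (\<open>bidual_adjunction\<close>). Now \<open>D\<close> is finitely generated and free. Take a
  basis \<open>e = \<phi>\<^sub>e\<^sup>Q\<close> of \<open>D\<close> with coordinate forms \<open>\<psi>\<^sub>e\<close>. The vectors \<open>c\<^sub>e = \<psi>\<^sub>e\<^sup>Q\<close> span the bidual and
  satisfy \<open>\<phi>\<^sub>e (c\<^sub>f) = \<delta>\<^sub>e\<^sub>f\<close>, so they are independent and \<open>x \<mapsto> \<Sum>\<^sub>e \<phi>\<^sub>e (x) c\<^sub>e\<close> projects \<open>M\<close> onto the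
  bidual. Hence \<open>M\<close> is the direct sum of the bidual and a submodule \<open>K\<close>, which is free as well, and
  the bidual has the same rank as \<open>D\<close> (\<open>bidual_decomposition\<close>).

  The three conditions all say \<open>K = 0\<close>. The bidual is a free factor of \<open>M\<close> that contains the \<open>x\<^sub>i\<close>,
  and it lies in every other such factor because that factor has the same dual; so algebraicity of
  \<open>M\<close> means that the bidual is \<open>M\<close>. And since \<open>D\<close> has the finite rank of the bidual, \<open>D\<close> and \<open>M\<close> have
  equal ranks exactly when a basis of \<open>K\<close> is empty.

  The ring theory behind this is that submodules of \<open>\<A>\<^sup>n\<close> are free (\<open>submodule_vecs_free\<close>) and that
  finite bases of a submodule have equally many elements (\<open>basis_card_unique\<close>).
  Left and right are treated at once: everything is proved for left modules over a multiplication
  \<open>\<odot>\<close> on the given additive group, which may be the multiplication of the ring or the opposite one.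
\<close>


section \<open>The multiplication and its opposite\<close>

section \<open>Submodules, independence and bases\<close>

definition linear_on ::
    "('a::ring_1 \<Rightarrow> 'b::ab_group_add \<Rightarrow> 'b) \<Rightarrow> ('a \<Rightarrow> 'c::ab_group_add \<Rightarrow> 'c) \<Rightarrow> 'b set \<Rightarrow> ('b \<Rightarrow> 'c) \<Rightarrow> bool"
  where "linear_on s t M f \<longleftrightarrow>
    (\<forall>x\<in>M. \<forall>y\<in>M. f (x + y) = f x + f y) \<and> (\<forall>a. \<forall>x\<in>M. f (s a x) = t a (f x))"

text \<open>
  Input only: used for output, this abbreviation would match every function term.
\<close>

abbreviation (input) opp :: "('a \<Rightarrow> 'a \<Rightarrow> 'a) \<Rightarrow> 'a \<Rightarrow> 'a \<Rightarrow> 'a" where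
  "opp f \<equiv> \<lambda>a b. f b a"

definition vscale :: "('a \<Rightarrow> 'a \<Rightarrow> 'a) \<Rightarrow> 'a \<Rightarrow> (nat \<Rightarrow> 'a) \<Rightarrow> nat \<Rightarrow> 'a" where
  "vscale f a v = (\<lambda>i. f a (v i))"

text \<open>
  The additive structure is that of the type, but \<open>\<odot>\<close> need not be its multiplication: the locale is
  used for \<open>(*)\<close> and for \<open>opp (*)\<close>, so that right modules become left modules without a second type.
\<close>

locale ring_mult =
  fixes mul :: "'a::ring_1 \<Rightarrow> 'a \<Rightarrow> 'a" (infixl "\<odot>" 70)
  assumes mul_assoc: "(a \<odot> b) \<odot> c = a \<odot> (b \<odot> c)"
    and mul_add_left: "(a + b) \<odot> c = a \<odot> c + b \<odot> c"
    and mul_add_right: "a \<odot> (b + c) = a \<odot> b + a \<odot> c"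
    and mul_one_left [simp]: "1 \<odot> a = a"
    and mul_one_right [simp]: "a \<odot> 1 = a"

locale module_over = ring_mult mul for mul :: "'a::ring_1 \<Rightarrow> 'a \<Rightarrow> 'a" (infixl "\<odot>" 70) +
  fixes s :: "'a \<Rightarrow> 'b::ab_group_add \<Rightarrow> 'b"
  assumes scale_add_right: "s a (x + y) = s a x + s a y"
    and scale_add_left: "s (a + b) x = s a x + s b x"
    and scale_scale: "s a (s b x) = s (a \<odot> b) x"
    and scale_one [simp]: "s 1 x = x"
begin

lemma scale_zero_right [simp]: "s a 0 = 0"
  using scale_add_right[of a 0 0] by simp

lemma scale_zero_left [simp]: "s 0 x = 0"
  using scale_add_left[of 0 0 x] by simp

lemma scale_minus_one: "s (- 1) x = - x"
  using scale_add_left[of 1 "- 1" x] by (simp add: eq_neg_iff_add_eq_0 add.commute)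

lemma scale_sum_right: "s a (sum f A) = (\<Sum>i\<in>A. s a (f i))"
  by (induction A rule: infinite_finite_induct) (simp_all add: scale_add_right)

lemma scale_sum_left: "s (sum f A) x = (\<Sum>i\<in>A. s (f i) x)"
  by (induction A rule: infinite_finite_induct) (simp_all add: scale_add_left)

lemma submodule_zero: "submodule s M \<Longrightarrow> 0 \<in> M"
  and submodule_add: "submodule s M \<Longrightarrow> x \<in> M \<Longrightarrow> y \<in> M \<Longrightarrow> x + y \<in> M"
  and submodule_scale: "submodule s M \<Longrightarrow> x \<in> M \<Longrightarrow> s a x \<in> M"
  by (auto simp: submodule_def)

lemma submodule_minus: "submodule s M \<Longrightarrow> x \<in> M \<Longrightarrow> - x \<in> M"
  using submodule_scale[of M x "- 1"] by (simp add: scale_minus_one)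

lemma submodule_diff: "submodule s M \<Longrightarrow> x \<in> M \<Longrightarrow> y \<in> M \<Longrightarrow> x - y \<in> M"
  using submodule_add[of M x "- y"] submodule_minus by simp

lemma submodule_sum: "submodule s M \<Longrightarrow> (\<And>i. i \<in> A \<Longrightarrow> f i \<in> M) \<Longrightarrow> sum f A \<in> M"
  by (induction A rule: infinite_finite_induct) (simp_all add: submodule_zero submodule_add)

lemma submodule_span [simp]: "submodule s (mod_span s S)"
  unfolding mod_span_def by (rule hull_in) (auto simp: submodule_def)

lemma span_superset: "S \<subseteq> mod_span s S"
  unfolding mod_span_def by (rule hull_subset)

lemma span_base: "x \<in> S \<Longrightarrow> x \<in> mod_span s S"
  using span_superset by blast

lemma combination_in_span: "g ` T \<subseteq> S \<Longrightarrow> (\<Sum>v\<in>T. s (c v) (g v)) \<in> mod_span s S"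
  by (intro submodule_sum[OF submodule_span] submodule_scale[OF submodule_span] span_base) auto

lemma span_minimal: "submodule s M \<Longrightarrow> S \<subseteq> M \<Longrightarrow> mod_span s S \<subseteq> M"
  unfolding mod_span_def by (rule hull_minimal)

lemma span_eqI: "submodule s M \<Longrightarrow> S \<subseteq> M \<Longrightarrow> M \<subseteq> mod_span s S \<Longrightarrow> mod_span s S = M"
  using span_minimal by blast

lemma span_mono: "S \<subseteq> T \<Longrightarrow> mod_span s S \<subseteq> mod_span s T"
  unfolding mod_span_def by (rule hull_mono)

lemma basis_span: "is_basis s B M \<Longrightarrow> mod_span s B = M"
  and basis_independent: "is_basis s B M \<Longrightarrow> mod_independent s B"
  by (auto simp: is_basis_def)

lemma basis_submodule: "is_basis s B M \<Longrightarrow> submodule s M"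
  using basis_span submodule_span by metis

lemma basis_subset: "is_basis s B M \<Longrightarrow> B \<subseteq> M"
  using basis_span span_superset by metis

lemma independentD:
  "mod_independent s B \<Longrightarrow> finite T \<Longrightarrow> T \<subseteq> B \<Longrightarrow> (\<Sum>v\<in>T. s (c v) v) = 0 \<Longrightarrow> v \<in> T \<Longrightarrow> c v = 0"
  unfolding mod_independent_def by blast

lemma independent_mono: "mod_independent s B \<Longrightarrow> A \<subseteq> B \<Longrightarrow> mod_independent s A"
  unfolding mod_independent_def by blast

lemma independent_zero_notin: "mod_independent s B \<Longrightarrow> 0 \<notin> B"
  using independentD[of B "{0}" "\<lambda>_. 1" 0] by auto

lemma span_explicit:
  "mod_span s S = {\<Sum>v\<in>T. s (c v) v | T c. finite T \<and> T \<subseteq> S}" (is "_ = ?R")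
proof (rule span_eqI)
  \<comment> \<open>Two combinations can be added once both run over the same index set.\<close>
  have sub: "\<exists>c'. (\<Sum>v\<in>T. s (c v) v) = (\<Sum>v\<in>U. s (c' v) v)" if "finite U" "T \<subseteq> U" for T U c
    by (rule exI[of _ "\<lambda>v. if v \<in> T then c v else 0"])
      (use that in \<open>auto intro!: sum.mono_neutral_cong_left\<close>)
  show "submodule s ?R"
    unfolding submodule_def
  proof (intro conjI ballI allI)
    show "0 \<in> ?R" by (rule CollectI, rule exI[of _ "{}"]) simp
  next
    fix x y assume "x \<in> ?R" "y \<in> ?R"
    then obtain T c U d where x: "x = (\<Sum>v\<in>T. s (c v) v)" "finite T" "T \<subseteq> S"
      and y: "y = (\<Sum>v\<in>U. s (d v) v)" "finite U" "U \<subseteq> S" by blast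
    obtain c' where c': "x = (\<Sum>v\<in>T\<union>U. s (c' v) v)"
      using sub[of "T\<union>U" T c] x y by auto
    obtain d' where d': "y = (\<Sum>v\<in>T\<union>U. s (d' v) v)"
      using sub[of "T\<union>U" U d] x y by auto
    have "x + y = (\<Sum>v\<in>T\<union>U. s (c' v + d' v) v)"
      by (simp add: c' d' scale_add_left sum.distrib)
    then show "x + y \<in> ?R" using x y by (intro CollectI exI[of _ "T\<union>U"] exI[of _ "\<lambda>v. c' v + d' v"]) auto
  next
    fix a x assume "x \<in> ?R"
    then obtain T c where x: "x = (\<Sum>v\<in>T. s (c v) v)" "finite T" "T \<subseteq> S" by blast
    have "s a x = (\<Sum>v\<in>T. s (a \<odot> c v) v)" by (simp add: x scale_sum_right scale_scale)
    then show "s a x \<in> ?R" using x by (intro CollectI exI[of _ T] exI[of _ "\<lambda>v. a \<odot> c v"]) auto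
  qed
  show "S \<subseteq> ?R"
  proof
    fix x assume "x \<in> S"
    then show "x \<in> ?R" by (intro CollectI exI[of _ "{x}"] exI[of _ "\<lambda>_. 1"]) auto
  qed
  show "?R \<subseteq> mod_span s S"
    using combination_in_span[of "\<lambda>v. v"] by auto
qed

lemma spanE:
  assumes "x \<in> mod_span s S"
  obtains T c where "finite T" "T \<subseteq> S" "x = (\<Sum>v\<in>T. s (c v) v)"
  using assms span_explicit by auto

lemma spanE_finite:
  assumes "x \<in> mod_span s S" "finite S"
  obtains c where "x = (\<Sum>v\<in>S. s (c v) v)"
proof -
  obtain T c where T: "finite T" "T \<subseteq> S" "x = (\<Sum>v\<in>T. s (c v) v)" using assms(1) by (rule spanE)
  have "x = (\<Sum>v\<in>S. s ((\<lambda>v. if v \<in> T then c v else 0) v) v)"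
    unfolding T(3) by (rule sum.mono_neutral_cong_left) (use T assms in auto)
  then show thesis by (rule that)
qed

lemma basisE:
  assumes "is_basis s B M" "x \<in> M"
  obtains T c where "finite T" "T \<subseteq> B" "x = (\<Sum>v\<in>T. s (c v) v)"
  using assms(2) unfolding basis_span[OF assms(1), symmetric] by (rule spanE)

lemma finite_basisE:
  assumes "is_basis s B M" "finite B" "x \<in> M"
  obtains c where "x = (\<Sum>v\<in>B. s (c v) v)"
  using assms(3) unfolding basis_span[OF assms(1), symmetric] by (rule spanE_finite[OF _ assms(2)])

lemma finite_subset_span:
  assumes "finite F" "F \<subseteq> mod_span s S"
  obtains T where "finite T" "T \<subseteq> S" "F \<subseteq> mod_span s T"
  using assms
proof (induction F arbitrary: thesis)
  case empty
  then show ?case by blast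
next
  case (insert x F)
  obtain T where T: "finite T" "T \<subseteq> S" "F \<subseteq> mod_span s T" using insert by blast
  obtain U c where U: "finite U" "U \<subseteq> S" "x = (\<Sum>v\<in>U. s (c v) v)"
    using insert.prems(2) by (auto elim: spanE)
  have "x \<in> mod_span s U"
    unfolding U(3) by (rule combination_in_span) simp
  moreover have "mod_span s T \<subseteq> mod_span s (T\<union>U)" "mod_span s U \<subseteq> mod_span s (T\<union>U)"
    by (auto intro: span_mono[THEN subsetD])
  ultimately show ?case using insert.prems(1)[of "T\<union>U"] T U by blast
qed

lemma independent_span_notin:
  assumes "mod_independent s B" "b \<in> B" "T \<subseteq> B" "b \<notin> T"
  shows "b \<notin> mod_span s T"
proof
  assume "b \<in> mod_span s T"
  then obtain U c where U: "finite U" "U \<subseteq> T" "b = (\<Sum>v\<in>U. s (c v) v)" by (rule spanE)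
  have bU: "b \<notin> U" using U assms by blast
  have "(\<Sum>v\<in>insert b U. s ((if v = b then - 1 else c v)) v) = s (-1) b + (\<Sum>v\<in>U. s (c v) v)"
    using U bU by (subst sum.insert) (auto intro!: sum.cong)
  also have "\<dots> = 0" using U by (simp add: scale_minus_one)
  finally have "(\<lambda>v. if v = b then - 1 else c v) b = 0"
    by (intro independentD[OF assms(1), of "insert b U"]) (use U assms in auto)
  then show False by simp
qed

text \<open>
  The finitely many generators involve only finitely many elements of the basis, and an independent
  set has no proper subset with the same span.
\<close>

lemma finitely_generated_basis_finite:
  assumes "is_basis s B M" "finite F" "M = mod_span s F"
  shows "finite B"
proof -
  have "F \<subseteq> mod_span s B" using assms span_superset basis_span by metis
  then obtain T where T: "finite T" "T \<subseteq> B" "F \<subseteq> mod_span s T"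
    using assms(2) by (blast elim: finite_subset_span)
  have "M \<subseteq> mod_span s T" using T assms span_minimal submodule_span by blast
  then have "B \<subseteq> T"
    using independent_span_notin[OF basis_independent[OF assms(1)] _ T(2)] basis_subset[OF assms(1)]
    by blast
  then show ?thesis using T finite_subset by blast
qed

lemma basis_direct_sum:
  assumes B: "is_basis s B M" and C: "is_basis s C N" and MN: "M \<inter> N \<subseteq> {0}"
    and P: "P = {x + y | x y. x \<in> M \<and> y \<in> N}"
  shows "is_basis s (B \<union> C) P" "B \<inter> C = {}"
proof -
  have M: "submodule s M" "B \<subseteq> M" and N: "submodule s N" "C \<subseteq> N"
    using B C basis_submodule basis_subset by auto
  have i: "mod_independent s B" "mod_independent s C" using B C basis_independent by auto
  show dis: "B \<inter> C = {}"
    using M N MN independent_zero_notin[OF i(1)] by blast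
  have "mod_independent s (B \<union> C)"
    unfolding mod_independent_def
  proof (intro allI impI ballI; elim conjE)
    fix T c v assume T: "finite T" "T \<subseteq> B \<union> C" "(\<Sum>v\<in>T. s (c v) v) = 0" and v: "v \<in> T"
    let ?x = "\<Sum>v\<in>T\<inter>B. s (c v) v" and ?y = "\<Sum>v\<in>T\<inter>C. s (c v) v"
    have "T = (T\<inter>B) \<union> (T\<inter>C)" using T by blast
    then have "(\<Sum>v\<in>T. s (c v) v) = ?x + ?y"
      using T(1) dis by (subst (1) \<open>T = _\<close>, subst sum.union_disjoint) auto
    then have *: "?x + ?y = 0" using T by simp
    have xM: "?x \<in> M" and yN: "?y \<in> N"
      using M N by (auto intro!: submodule_sum submodule_scale)
    have "?x = - ?y" using * by (simp add: eq_neg_iff_add_eq_0)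
    then have x0: "?x = 0" using xM submodule_minus[OF N(1) yN] MN by auto
    then have y0: "?y = 0" using * by simp
    show "c v = 0"
    proof (cases "v \<in> B")
      case True
      then show ?thesis using independentD[OF i(1) _ _ x0, of v] T(1) v by blast
    next
      case False
      then show ?thesis using independentD[OF i(2) _ _ y0, of v] T(1,2) v by blast
    qed
  qed
  moreover have "mod_span s (B \<union> C) = P"
  proof (rule span_eqI)
    show "submodule s P"
      unfolding submodule_def
    proof (intro conjI ballI allI)
      show "0 \<in> P" unfolding P using M N submodule_zero
        by (intro CollectI exI[of _ 0]) auto
    next
      fix x y assume "x \<in> P" "y \<in> P"
      then obtain a b c d where "x = a + b" "y = c + d" "a \<in> M" "c \<in> M" "b \<in> N" "d \<in> N"
        unfolding P by blast
      then show "x + y \<in> P" unfolding P using M N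
        by (intro CollectI exI[of _ "a + c"] exI[of _ "b + d"]) (auto intro: submodule_add)
    next
      fix a x assume "x \<in> P"
      then obtain b c where "x = b + c" "b \<in> M" "c \<in> N"
        unfolding P by blast
      then show "s a x \<in> P" unfolding P using M N
        by (intro CollectI exI[of _ "s a b"] exI[of _ "s a c"]) (auto intro: submodule_scale simp: scale_add_right)
    qed
    show "B \<union> C \<subseteq> P"
    proof
      fix x assume "x \<in> B \<union> C"
      then consider "x \<in> M" | "x \<in> N" using M N by blast
      then show "x \<in> P"
      proof cases
        case 1
        then show ?thesis unfolding P using submodule_zero[OF N(1)]
          by (intro CollectI exI[of _ x] exI[of _ 0]) auto
      next
        case 2
        then show ?thesis unfolding P using submodule_zero[OF M(1)]
          by (intro CollectI exI[of _ 0] exI[of _ x]) auto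
      qed
    qed
    have "M \<subseteq> mod_span s (B \<union> C)" "N \<subseteq> mod_span s (B \<union> C)"
      using basis_span[OF B] basis_span[OF C] span_mono[of B "B \<union> C"] span_mono[of C "B \<union> C"] by auto
    then show "P \<subseteq> mod_span s (B \<union> C)" unfolding P by (auto intro!: submodule_add)
  qed
  ultimately show "is_basis s (B \<union> C) P" by (simp add: is_basis_def)
qed

end

section \<open>Linear maps\<close>

lemma linear_onI:
  "(\<And>x y. x \<in> M \<Longrightarrow> y \<in> M \<Longrightarrow> f (x + y) = f x + f y) \<Longrightarrow>
   (\<And>a x. x \<in> M \<Longrightarrow> f (s a x) = t a (f x)) \<Longrightarrow> linear_on s t M f"
  by (simp add: linear_on_def)

lemma linear_on_subset: "linear_on s t M f \<Longrightarrow> L \<subseteq> M \<Longrightarrow> linear_on s t L f"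
  unfolding linear_on_def by blast

locale module_pair = V: module_over mul s + W: module_over mul t
  for mul :: "'a::ring_1 \<Rightarrow> 'a \<Rightarrow> 'a" (infixl "\<odot>" 70)
    and s :: "'a \<Rightarrow> 'b::ab_group_add \<Rightarrow> 'b" and t :: "'a \<Rightarrow> 'c::ab_group_add \<Rightarrow> 'c"
begin

lemma linear_on_add: "linear_on s t M f \<Longrightarrow> x \<in> M \<Longrightarrow> y \<in> M \<Longrightarrow> f (x + y) = f x + f y"
  and linear_on_scale: "linear_on s t M f \<Longrightarrow> x \<in> M \<Longrightarrow> f (s a x) = t a (f x)"
  by (auto simp: linear_on_def)

lemma linear_on_zero: "linear_on s t M f \<Longrightarrow> submodule s M \<Longrightarrow> f 0 = 0"
  using linear_on_scale[of M f 0 0] V.submodule_zero by simp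

lemma linear_on_diff:
  "linear_on s t M f \<Longrightarrow> submodule s M \<Longrightarrow> x \<in> M \<Longrightarrow> y \<in> M \<Longrightarrow> f (x - y) = f x - f y"
  using linear_on_add[of M f "x - y" y] V.submodule_diff[of M x y] by (simp add: eq_diff_eq)

lemma linear_on_sum:
  "linear_on s t M f \<Longrightarrow> submodule s M \<Longrightarrow> (\<And>i. i \<in> A \<Longrightarrow> g i \<in> M) \<Longrightarrow> f (sum g A) = (\<Sum>i\<in>A. f (g i))"
  by (induction A rule: infinite_finite_induct)
    (simp_all add: linear_on_zero linear_on_add V.submodule_sum)

lemma linear_on_combination:
  assumes "linear_on s t M f" "submodule s M" "\<And>i. i \<in> A \<Longrightarrow> g i \<in> M"
  shows "f (\<Sum>i\<in>A. s (c i) (g i)) = (\<Sum>i\<in>A. t (c i) (f (g i)))"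
  using assms by (subst linear_on_sum[OF assms(1,2)]) (auto simp: linear_on_scale V.submodule_scale)

lemma linear_on_eqI:
  assumes f: "linear_on s t M f" and g: "linear_on s t M g" and M: "M = mod_span s B"
    and eq: "\<And>b. b \<in> B \<Longrightarrow> f b = g b" and x: "x \<in> M"
  shows "f x = g x"
proof -
  obtain T c where T: "T \<subseteq> B" "x = (\<Sum>v\<in>T. s (c v) v)" using x M by (auto elim: V.spanE)
  have "submodule s M" "T \<subseteq> M" using M T V.span_superset by auto
  then show ?thesis using eq T f g
    by (auto simp: linear_on_combination[where g = "\<lambda>v. v"] subset_iff intro!: sum.cong)
qed

lemma submodule_kernel:
  assumes "linear_on s t M f" "submodule s M"
  shows "submodule s {x\<in>M. f x = 0}"
  using assms
  by (auto simp: submodule_def linear_on_zero linear_on_add linear_on_scale)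

lemma submodule_image:
  assumes f: "linear_on s t M f" and M: "submodule s M"
  shows "submodule t (f ` M)"
  unfolding submodule_def
proof (intro conjI ballI allI)
  show "0 \<in> f ` M" using linear_on_zero[OF f M] V.submodule_zero[OF M] by (metis imageI)
next
  fix x y assume "x \<in> f ` M" "y \<in> f ` M"
  then show "x + y \<in> f ` M" using linear_on_add[OF f] V.submodule_add[OF M] by force
next
  fix a x assume "x \<in> f ` M"
  then show "t a x \<in> f ` M"
    using linear_on_scale[OF f, symmetric] V.submodule_scale[OF M] by auto
qed

text \<open>
  A linear map can be prescribed arbitrarily on a basis. Its graph is the submodule of the product
  generated by the pairs \<open>(b, h b)\<close>; independence of the basis makes this submodule single-valued.
\<close>

lemma linear_extension:
  assumes B: "is_basis s B M"
  obtains f where "linear_on s t M f" "\<And>b. b \<in> B \<Longrightarrow> f b = h b"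
proof -
  define p where "p a x = (s a (fst x), t a (snd x))" for a and x :: "'b \<times> 'c"
  interpret P: module_over mul p
    by unfold_locales
      (auto simp: p_def V.scale_add_left V.scale_add_right V.scale_scale
        W.scale_add_left W.scale_add_right W.scale_scale)
  define G where "G = mod_span p ((\<lambda>b. (b, h b)) ` B)"
  have G: "submodule p G" by (simp add: G_def)
  have G_B: "(b, h b) \<in> G" if "b \<in> B" for b
    using P.span_superset that unfolding G_def by fast
  have repr: "\<exists>T c. finite T \<and> T \<subseteq> B \<and> z = (\<Sum>b\<in>T. p (c b) (b, h b))" if z: "z \<in> G" for z
  proof -
    obtain T c where T: "finite T" "T \<subseteq> (\<lambda>b. (b, h b)) ` B" "z = (\<Sum>v\<in>T. p (c v) v)"
      using z unfolding G_def by (rule P.spanE)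
    obtain U where U: "finite U" "U \<subseteq> B" "T = (\<lambda>b. (b, h b)) ` U"
      using T finite_subset_image by meson
    have "z = (\<Sum>b\<in>U. p (c (b, h b)) (b, h b))"
      unfolding T(3) U(3) by (subst sum.reindex) (auto simp: inj_on_def)
    then show ?thesis using U by (intro exI[of _ U] exI[of _ "\<lambda>b. c (b, h b)"]) auto
  qed
  have fst_snd: "fst (\<Sum>b\<in>T. p (c b) (b, h b)) = (\<Sum>b\<in>T. s (c b) b)"
    "snd (\<Sum>b\<in>T. p (c b) (b, h b)) = (\<Sum>b\<in>T. t (c b) (h b))" for T c
    by (simp_all add: fst_sum snd_sum p_def)
  have zero: "y = 0" if "(0, y) \<in> G" for y
  proof -
    obtain T c where T: "finite T" "T \<subseteq> B" "(0, y) = (\<Sum>b\<in>T. p (c b) (b, h b))"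
      using repr[OF \<open>(0,y) \<in> G\<close>] by auto
    have "(\<Sum>b\<in>T. s (c b) b) = 0" "y = (\<Sum>b\<in>T. t (c b) (h b))"
      using fst_snd[of c T] T(3) by (metis fst_conv, metis snd_conv)
    moreover have "c b = 0" if "b \<in> T" for b
      using V.independentD[OF V.basis_independent[OF B] T(1,2)] calculation(1) that by blast
    ultimately show ?thesis by simp
  qed
  have uniq: "y = z" if "(x, y) \<in> G" "(x, z) \<in> G" for x y z
    using P.submodule_diff[OF G that] zero[of "y - z"] by simp
  have ex: "\<exists>y. (x, y) \<in> G" if "x \<in> M" for x
  proof -
    obtain T c where T: "finite T" "T \<subseteq> B" "x = (\<Sum>b\<in>T. s (c b) b)"
      by (rule V.basisE[OF B \<open>x \<in> M\<close>])
    have "(\<Sum>b\<in>T. p (c b) (b, h b)) \<in> G"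
      using T G_B by (intro P.submodule_sum[OF G] P.submodule_scale[OF G]) auto
    moreover have "(\<Sum>b\<in>T. p (c b) (b, h b)) = (x, (\<Sum>b\<in>T. t (c b) (h b)))"
      using fst_snd[of c T] T(3) by (simp add: prod_eq_iff)
    ultimately show ?thesis by auto
  qed
  define f where "f x = (SOME y. (x, y) \<in> G)" for x
  have fG: "(x, f x) \<in> G" if "x \<in> M" for x
    unfolding f_def using ex[OF that] by (rule someI_ex)
  have M: "submodule s M" "B \<subseteq> M" using B V.basis_submodule V.basis_subset by auto
  show thesis
  proof (rule that)
    show "linear_on s t M f"
    proof (rule linear_onI)
      fix x y assume "x \<in> M" "y \<in> M"
      then show "f (x + y) = f x + f y"
        using P.submodule_add[OF G fG fG] fG V.submodule_add[OF M(1)] by (intro uniq[of "x + y"]) auto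
    next
      fix a x assume "x \<in> M"
      then show "f (s a x) = t a (f x)"
        using P.submodule_scale[OF G fG[of x], of a] fG V.submodule_scale[OF M(1)]
        by (intro uniq[of "s a x"]) (auto simp: p_def)
    qed
    show "f b = h b" if "b \<in> B" for b
      using that M G_B fG by (intro uniq[of b]) auto
  qed
qed

text \<open>
  The rest of a basis of \<open>M\<close> can be sent anywhere, for instance to the values that \<open>f\<close> takes there.
\<close>

lemma linear_extension_free_factor:
  assumes LM: "free_factor s L M" and f: "linear_on s t L f"
  obtains g where "linear_on s t M g" "\<And>x. x \<in> L \<Longrightarrow> g x = f x"
proof -
  obtain B C where BC: "is_basis s B L" "B \<subseteq> C" "is_basis s C M"
    using LM unfolding free_factor_def by blast
  obtain g where g: "linear_on s t M g" "\<And>b. b \<in> C \<Longrightarrow> g b = f b"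
    using linear_extension[OF BC(3)] by blast
  have "L \<subseteq> M" using BC V.basis_span V.span_mono by metis
  then have "g x = f x" if "x \<in> L" for x
    using linear_on_eqI[OF linear_on_subset[OF g(1)] f _ _ that] g(2) BC V.basis_span by blast
  then show thesis using g that by blast
qed

text \<open>
  Lifting a basis of the image splits the map, so \<open>M\<close> is the direct sum of the kernel and of the
  span of the lifts. This is how freeness passes from ideals to submodules of \<open>\<A>\<^sup>n\<close>, and how the ring
  is seen to have no zero divisors.
\<close>

lemma basis_of_split_extension:
  assumes f: "linear_on s t M f" and M: "submodule s M"
    and E: "is_basis t E (f ` M)" and B: "is_basis s B {x\<in>M. f x = 0}"
  obtains h where "inj_on h E" "B \<inter> h ` E = {}" "is_basis s (B \<union> h ` E) M"
proof -
  have "\<forall>e\<in>E. \<exists>x\<in>M. f x = e" using W.basis_subset[OF E] by blast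
  then obtain h where h: "\<And>e. e \<in> E \<Longrightarrow> h e \<in> M" "\<And>e. e \<in> E \<Longrightarrow> f (h e) = e" by metis
  have inj: "inj_on h E" using h(2) by (metis inj_onI)
  \<comment> \<open>Even modulo the kernel the lifts are independent, because \<open>f\<close> maps them to \<open>E\<close>.\<close>
  have lift: "c v = 0"
    if U: "finite U" "U \<subseteq> h ` E" "f (\<Sum>v\<in>U. s (c v) v) = 0" and v: "v \<in> U" for U c v
  proof -
    have "f (\<Sum>v\<in>U. s (c v) v) = (\<Sum>v\<in>U. t (c v) (f v))"
      using U h by (intro linear_on_combination[OF f M]) auto
    also have "\<dots> = (\<Sum>e\<in>f`U. t (c (h e)) e)"
    proof (rule sum.reindex_cong[symmetric])
      show "inj_on f U"
      proof (rule inj_on_inverseI)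
        show "h (f v) = v" if "v \<in> U" for v using that U(2) h(2) by auto
      qed
      show "t (c (h (f v))) (f v) = t (c v) (f v)" if "v \<in> U" for v using that U(2) h(2) by auto
    qed simp
    finally have "(\<Sum>e\<in>f`U. t ((\<lambda>e. c (h e)) e) e) = 0" using U by simp
    then have "c (h (f v)) = 0"
      using W.independentD[OF W.basis_independent[OF E], of "f ` U" "\<lambda>e. c (h e)" "f v"] U h v by fastforce
    then show "c v = 0" using U h v by fastforce
  qed
  have hind: "mod_independent s (h ` E)"
    unfolding mod_independent_def using lift linear_on_zero[OF f M] by metis
  let ?N = "mod_span s (h ` E)"
  have N: "?N \<subseteq> M" using h by (intro V.span_minimal[OF M]) auto
  have "{x\<in>M. f x = 0} \<inter> ?N \<subseteq> {0}"
  proof safe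
    fix x assume x: "x \<in> ?N" "f x = 0"
    obtain U c where U: "finite U" "U \<subseteq> h ` E" "x = (\<Sum>v\<in>U. s (c v) v)" using x(1) by (rule V.spanE)
    then have "\<And>v. v \<in> U \<Longrightarrow> c v = 0" using lift x(2) by blast
    then show "x = 0" using U by simp
  qed
  moreover have "M = {x + y | x y. x \<in> {x\<in>M. f x = 0} \<and> y \<in> ?N}"
  proof (intro equalityI subsetI)
    fix x assume x: "x \<in> M"
    obtain U c where U: "finite U" "U \<subseteq> E" "f x = (\<Sum>v\<in>U. t (c v) v)"
      by (rule W.basisE[OF E, of "f x"]) (use x in auto)
    define y where "y = (\<Sum>e\<in>U. s (c e) (h e))"
    have y: "y \<in> ?N" unfolding y_def
      using U by (auto intro!: V.combination_in_span)
    have "f y = f x" unfolding y_def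
      using U h by (subst linear_on_combination[OF f M]) (auto intro!: sum.cong)
    then have "x - y \<in> {x\<in>M. f x = 0}"
      using x y N V.submodule_diff[OF M] linear_on_diff[OF f M] by auto
    then show "x \<in> {x + y | x y. x \<in> {x\<in>M. f x = 0} \<and> y \<in> ?N}"
      using y by (intro CollectI exI[of _ "x - y"] exI[of _ y]) auto
  next
    fix x assume "x \<in> {x + y | x y. x \<in> {x\<in>M. f x = 0} \<and> y \<in> ?N}"
    then show "x \<in> M" using N V.submodule_add[OF M] by auto
  qed
  ultimately show thesis
    using V.basis_direct_sum[OF B _ , of "h ` E" ?N M] hind inj that by (simp add: is_basis_def)
qed

lemma basis_injective_image:
  assumes f: "linear_on s t M f" and B: "is_basis s B M" and inj: "inj_on f M"
  shows "is_basis t (f ` B) (f ` M)"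
proof -
  have M: "submodule s M" "B \<subseteq> M" using B V.basis_submodule V.basis_subset by auto
  have img: "submodule t (f ` M)" by (rule submodule_image[OF f M(1)])
  have "mod_independent t (f ` B)"
    unfolding mod_independent_def
  proof (intro allI impI ballI; elim conjE)
    fix T c v assume T: "finite T" "T \<subseteq> f ` B" "(\<Sum>v\<in>T. t (c v) v) = 0" and v: "v \<in> T"
    obtain U where U: "finite U" "U \<subseteq> B" "T = f ` U" using T finite_subset_image by meson
    have "f (\<Sum>u\<in>U. s (c (f u)) u) = (\<Sum>u\<in>U. t (c (f u)) (f u))"
      using U M by (intro linear_on_combination[OF f M(1)]) auto
    also have "\<dots> = (\<Sum>v\<in>T. t (c v) v)"
      unfolding U(3) using U M by (subst sum.reindex) (auto intro: inj_on_subset[OF inj])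
    finally have "f (\<Sum>u\<in>U. s (c (f u)) u) = f 0" using T linear_on_zero[OF f M(1)] by simp
    moreover have "(\<Sum>u\<in>U. s (c (f u)) u) \<in> M"
      using U M by (intro V.submodule_sum V.submodule_scale) auto
    ultimately have "(\<Sum>u\<in>U. s (c (f u)) u) = 0"
      using inj V.submodule_zero[OF M(1)] by (auto dest: inj_onD)
    then show "c v = 0" using V.independentD[OF V.basis_independent[OF B] U(1,2), of "\<lambda>u. c (f u)"] U(3) v by blast
  qed
  moreover have "mod_span t (f ` B) = f ` M"
  proof (rule W.span_eqI[OF img])
    show "f ` B \<subseteq> f ` M" using M by blast
    show "f ` M \<subseteq> mod_span t (f ` B)"
    proof
      fix y assume "y \<in> f ` M"
      then obtain x where x: "x \<in> M" "y = f x" by blast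
      obtain T c where T: "finite T" "T \<subseteq> B" "x = (\<Sum>b\<in>T. s (c b) b)"
        using x(1) by (rule V.basisE[OF B])
      have "y = (\<Sum>b\<in>T. t (c b) (f b))"
        unfolding x T(3) using T M by (intro linear_on_combination[OF f M(1)]) auto
      then show "y \<in> mod_span t (f ` B)"
        using T by (auto intro!: W.combination_in_span)
    qed
  qed
  ultimately show ?thesis by (simp add: is_basis_def)
qed

end

section \<open>Unique rank and freeness of submodules\<close>

lemma card_of_ordIso_imp_card:
  assumes "|A| =o |B|" "finite B"
  shows "finite A" "card A = card B"
proof -
  obtain f where "bij_betw f A B" using assms(1) card_of_ordIso by blast
  then show "finite A" "card A = card B" using assms(2) bij_betw_finite bij_betw_same_card by blast+
qed

text \<open>
  Only left ideals are constrained here, for this is all that freeness and uniqueness of rank of left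
  modules require; duality adds the same condition for the opposite multiplication.
\<close>

locale left_fir = ring_mult mul for mul :: "'a::ring_1 \<Rightarrow> 'a \<Rightarrow> 'a" (infixl "\<odot>" 70) +
  assumes ideal_free: "submodule (\<odot>) I \<Longrightarrow> free_of_unique_rank (\<odot>) I"
begin

sublocale ideal: module_over mul mul
  by unfold_locales (simp_all add: mul_add_left mul_add_right mul_assoc)

sublocale vec: module_over mul "vscale mul"
  by unfold_locales (simp_all add: vscale_def fun_eq_iff mul_add_left mul_add_right mul_assoc)

sublocale endo: module_pair mul mul mul
  by unfold_locales

sublocale form: module_pair mul "vscale mul" mul
  by unfold_locales

abbreviation "vs \<equiv> vscale (\<odot>)"

lemma ideal_basis:
  assumes "submodule (\<odot>) I"
  obtains E where "is_basis (\<odot>) E I"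
  using ideal_free[OF assms] unfolding free_of_unique_rank_def by blast

lemma ideal_unique_rank: "is_basis (\<odot>) B I \<Longrightarrow> is_basis (\<odot>) C I \<Longrightarrow> |B| =o |C|"
  using ideal_free[OF ideal.basis_submodule, of B I] unfolding free_of_unique_rank_def by blast

lemma basis_one: "is_basis (\<odot>) {1} UNIV"
  unfolding is_basis_def
proof
  show "mod_independent (\<odot>) {1}"
    unfolding mod_independent_def
  proof (intro allI impI ballI; elim conjE)
    fix T c v assume "finite T" "T \<subseteq> {1}" "(\<Sum>v\<in>T. c v \<odot> v) = 0" "v \<in> T"
    then show "c v = 0" by (cases "T = {1}") auto
  qed
  show "mod_span (\<odot>) {1} = UNIV"
    using ideal.submodule_scale[OF ideal.submodule_span ideal.span_base, of 1 "{1}"] by auto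
qed

text \<open>
  The map \<open>x \<mapsto> x \<odot> b\<close> splits onto its nonzero image, so a basis of its kernel together with a
  nonempty set is a basis of the ring. The latter has rank one, which leaves nothing for the kernel.
\<close>

lemma no_zero_divisors:
  assumes "a \<odot> b = 0" "b \<noteq> 0"
  shows "a = 0"
proof -
  have f: "linear_on (\<odot>) (\<odot>) UNIV (\<lambda>x. x \<odot> b)"
    by (rule linear_onI) (simp_all add: mul_add_left mul_assoc)
  have U: "submodule (\<odot>) UNIV" by (simp add: submodule_def)
  obtain E where E: "is_basis (\<odot>) E (range (\<lambda>x. x \<odot> b))"
    using ideal_basis[OF endo.submodule_image[OF f U]] .
  obtain B where B: "is_basis (\<odot>) B {x\<in>UNIV. x \<odot> b = 0}"
    using ideal_basis[OF endo.submodule_kernel[OF f U]] .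
  obtain h where h: "inj_on h E" "B \<inter> h ` E = {}" "is_basis (\<odot>) (B \<union> h ` E) UNIV"
    using endo.basis_of_split_extension[OF f U E B] .
  have "finite (B \<union> h ` E)" "card (B \<union> h ` E) = 1"
    using card_of_ordIso_imp_card[OF ideal_unique_rank[OF h(3) basis_one]] by auto
  moreover have "E \<noteq> {}"
  proof
    assume "E = {}"
    then have "range (\<lambda>x. x \<odot> b) = {0}"
      using ideal.basis_span[OF E] by (simp add: ideal.span_explicit)
    moreover have "1 \<odot> b \<in> range (\<lambda>x. x \<odot> b)" by blast
    ultimately show False using assms(2) by simp
  qed
  then have "h ` E \<noteq> {}" by simp
  ultimately have "B = {}"
    using h(2) by (simp add: card_Un_disjoint card_eq_0_iff add_is_1)
  then have "{x\<in>UNIV. x \<odot> b = 0} = {0}"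
    using ideal.basis_span[OF B] by (simp add: ideal.span_explicit)
  then show "a = 0" using assms(1) by blast
qed

text \<open>
  If the nonzero left ideals generated by \<open>a\<close> and \<open>b\<close> meet in \<open>0\<close>, then \<open>b, b a, b a\<^sup>2, \<dots>\<close> are
  independent: the first term of a relation lies in the ideal of \<open>b\<close>, the sum of all others in the
  ideal of \<open>a\<close>, and cancelling \<open>a\<close> leaves a shorter relation.
\<close>

lemma powers_independent:
  assumes ab: "a \<noteq> 0" "b \<noteq> 0" "\<forall>x y. x \<odot> a = y \<odot> b \<longrightarrow> x \<odot> a = 0"
    and "(\<Sum>i<n. c i \<odot> ((\<lambda>x. x \<odot> a) ^^ i) b) = 0" "i < n"
  shows "c i = 0"
  using assms(4,5)
proof (induction n arbitrary: c i)
  case 0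
  then show ?case by simp
next
  case (Suc n)
  let ?p = "\<lambda>i. ((\<lambda>x. x \<odot> a) ^^ i) b" and ?S = "\<Sum>i<n. c (Suc i) \<odot> ((\<lambda>x. x \<odot> a) ^^ i) b"
  have "(\<Sum>i<n. c (Suc i) \<odot> ?p (Suc i)) = ?S \<odot> a"
    by (simp add: ideal.scale_sum_left mul_assoc)
  then have *: "c 0 \<odot> b + ?S \<odot> a = 0"
    using Suc.prems(1) by (subst (asm) sum.lessThan_Suc_shift) simp
  then have "?S \<odot> a = (- c 0) \<odot> b"
    using mul_add_left[of "c 0" "- c 0" b] by (simp add: add_eq_0_iff)
  then have Sa: "?S \<odot> a = 0" using ab(3) by blast
  then have S: "?S = 0" using ab(1) by (rule no_zero_divisors)
  have "c 0 \<odot> b = 0" using * Sa by simp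
  then have "c 0 = 0" using ab(2) by (rule no_zero_divisors)
  then show ?case using Suc.IH[of "\<lambda>i. c (Suc i)"] S Suc.prems(2) by (cases i) auto
qed

text \<open>
  Gaussian elimination over a left Ore domain: more vectors than coordinates are dependent. Common
  multiples replace division, so each vector is multiplied by \<open>v j \<noteq> 0\<close> before a multiple of the pivot
  row \<open>p\<close> is added to it.
\<close>

lemma dependent_of_ore:
  assumes ore: "\<And>a b. a \<noteq> 0 \<Longrightarrow> b \<noteq> 0 \<Longrightarrow> \<exists>x y. x \<odot> a = y \<odot> b \<and> x \<odot> a \<noteq> 0"
    and "finite J" "n < card J"
  shows "\<exists>y. (\<exists>j\<in>J. y j \<noteq> 0) \<and> (\<forall>i<n. (\<Sum>j\<in>J. y j \<odot> X j i) = 0)"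
  using assms(2,3)
proof (induction n arbitrary: J X)
  case 0
  then show ?case by (intro exI[of _ "\<lambda>_. 1"]) (auto simp: card_gt_0_iff)
next
  case (Suc n)
  show ?case
  proof (cases "\<forall>j\<in>J. X j n = 0")
    case True
    obtain y where "\<exists>j\<in>J. y j \<noteq> 0" "\<forall>i<n. (\<Sum>j\<in>J. y j \<odot> X j i) = 0"
      using Suc.IH[of J X] Suc.prems by auto
    then show ?thesis using True by (intro exI[of _ y]) (auto simp: less_Suc_eq)
  next
    case False
    then obtain p where p: "p \<in> J" "X p n \<noteq> 0" by blast
    have "\<exists>u v. v \<noteq> 0 \<and> u \<odot> X p n + v \<odot> X j n = 0" for j
    proof (cases "X j n = 0")
      case True
      then show ?thesis by (intro exI[of _ 0] exI[of _ 1]) simp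
    next
      case False
      then obtain x y where "x \<odot> X p n = y \<odot> X j n" "x \<odot> X p n \<noteq> 0" using ore p by blast
      moreover have "(- x) \<odot> X p n + x \<odot> X p n = 0"
        using mul_add_left[of "- x" x "X p n"] by simp
      ultimately show ?thesis by (intro exI[of _ "- x"] exI[of _ y]) auto
    qed
    then obtain u v where uv: "\<And>j. v j \<noteq> 0" "\<And>j. u j \<odot> X p n + v j \<odot> X j n = 0" by metis
    let ?J = "J - {p}"
    have J: "finite ?J" "n < card ?J" using Suc.prems p by auto
    obtain y where y: "\<exists>j\<in>?J. y j \<noteq> 0"
      "\<forall>i<n. (\<Sum>j\<in>?J. y j \<odot> (u j \<odot> X p i + v j \<odot> X j i)) = 0"
      using Suc.IH[OF J, of "\<lambda>j i. u j \<odot> X p i + v j \<odot> X j i"] by blast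
    define z where "z j = (if j = p then \<Sum>j\<in>?J. y j \<odot> u j else y j \<odot> v j)" for j
    have z: "(\<Sum>j\<in>J. z j \<odot> X j i) = (\<Sum>j\<in>?J. y j \<odot> (u j \<odot> X p i + v j \<odot> X j i))" for i
    proof -
      have "(\<Sum>j\<in>J. z j \<odot> X j i) = z p \<odot> X p i + (\<Sum>j\<in>?J. z j \<odot> X j i)"
        using Suc.prems(1) p by (simp add: sum.remove)
      also have "(\<Sum>j\<in>?J. z j \<odot> X j i) = (\<Sum>j\<in>?J. y j \<odot> v j \<odot> X j i)"
        by (rule sum.cong) (auto simp: z_def)
      also have "z p \<odot> X p i = (\<Sum>j\<in>?J. y j \<odot> u j \<odot> X p i)"
        by (simp add: z_def ideal.scale_sum_left)
      finally show ?thesis by (simp add: sum.distrib mul_add_right mul_assoc)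
    qed
    have "\<exists>j\<in>J. z j \<noteq> 0"
    proof -
      obtain j where "j \<in> ?J" "y j \<noteq> 0" using y by blast
      then have "j \<in> J" "z j \<noteq> 0" using no_zero_divisors[OF _ uv(1)] by (auto simp: z_def)
      then show ?thesis by blast
    qed
    moreover have "(\<Sum>j\<in>J. z j \<odot> X j i) = 0" if "i < Suc n" for i
      using that y(2) uv(2) by (auto simp: z less_Suc_eq)
    ultimately show ?thesis by blast
  qed
qed

text \<open>
  The hypothesis on ranks concerns ideals only. If two nonzero left ideals meet in \<open>0\<close>, the ring
  contains free left ideals of every finite rank, so \<open>M\<close> embeds as a left ideal and the hypothesis
  applies to it. Otherwise the ring is a left Ore domain, where linear dependence works as over a
  field.
\<close>

lemma basis_card_unique:
  assumes B: "is_basis vs B M" and C: "is_basis vs C M" and finB: "finite B"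
  shows "finite C" "card C = card B"
proof -
  show finC: "finite C"
    using vec.finitely_generated_basis_finite[OF C finB] vec.basis_span[OF B] by simp
  show "card C = card B"
  proof (cases "\<exists>a b. a \<noteq> 0 \<and> b \<noteq> 0 \<and> (\<forall>x y. x \<odot> a = y \<odot> b \<longrightarrow> x \<odot> a = 0)")
    case True
    then obtain a b where ab: "a \<noteq> 0" "b \<noteq> 0" "\<forall>x y. x \<odot> a = y \<odot> b \<longrightarrow> x \<odot> a = 0" by blast
    let ?p = "\<lambda>i. ((\<lambda>x. x \<odot> a) ^^ i) b"
    obtain g where g: "bij_betw g {..<card B} B"
      using ex_bij_betw_nat_finite[OF finB] by (auto simp: atLeast0LessThan)
    obtain f where f: "linear_on vs (\<odot>) M f"
      "\<And>b. b \<in> B \<Longrightarrow> f b = ?p (the_inv_into {..<card B} g b)"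
      using form.linear_extension[OF B, of "\<lambda>b'. ?p (the_inv_into {..<card B} g b')"] by blast
    have M: "submodule vs M" "B \<subseteq> M" using B vec.basis_submodule vec.basis_subset by auto
    have fg: "f (g i) = ?p i" if "i < card B" for i
      using f(2)[of "g i"] the_inv_into_f_f[of g "{..<card B}" i] g that by (auto simp: bij_betw_def)
    have zero: "x = 0" if "x \<in> M" "f x = 0" for x
    proof -
      obtain c where c: "x = (\<Sum>b\<in>B. vs (c b) b)"
        by (rule vec.finite_basisE[OF B finB \<open>x \<in> M\<close>])
      have "f x = (\<Sum>b\<in>B. c b \<odot> f b)"
        unfolding c by (rule form.linear_on_combination[OF f(1) M(1)]) (use M in auto)
      also have "\<dots> = (\<Sum>i<card B. c (g i) \<odot> ?p i)"
        by (subst sum.reindex_bij_betw[OF g, symmetric]) (simp add: fg)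
      finally have "(\<Sum>i<card B. c (g i) \<odot> ?p i) = 0" using that by simp
      then have "c (g i) = 0" if "i < card B" for i
        using powers_independent[OF ab, where c = "\<lambda>i. c (g i)"] that by blast
      then have "c e = 0" if "e \<in> g ` {..<card B}" for e
        using that by auto
      then have "c e = 0" if "e \<in> B" for e
        using that bij_betw_imp_surj_on[OF g] by simp
      then show ?thesis by (simp add: c)
    qed
    have "inj_on f M"
    proof (rule inj_onI)
      fix x y assume "x \<in> M" "y \<in> M" "f x = f y"
      then show "x = y"
        using zero[of "x - y"] form.linear_on_diff[OF f(1) M(1)] vec.submodule_diff[OF M(1)] by simp
    qed
    note injM = this
    have "is_basis (\<odot>) (f ` B) (f ` M)" "is_basis (\<odot>) (f ` C) (f ` M)"
      using form.basis_injective_image[OF f(1) _ injM] B C by simp_all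
    then have "card (f ` C) = card (f ` B)"
      using card_of_ordIso_imp_card(2)[OF ideal_unique_rank[of "f ` C" "f ` M" "f ` B"]] finB by simp
    then show ?thesis
      using inj_on_subset[OF injM vec.basis_subset[OF B]] inj_on_subset[OF injM vec.basis_subset[OF C]]
      by (simp add: card_image)
  next
    case False
    then have ore: "\<exists>x y. x \<odot> a = y \<odot> b \<and> x \<odot> a \<noteq> 0" if "a \<noteq> 0" "b \<noteq> 0" for a b
      using that by blast
    have "\<not> card B < card C" if B: "is_basis vs B M" "finite B" and C: "is_basis vs C M" "finite C" for B C
    proof
      assume lt: "card B < card C"
      obtain g where g: "bij_betw g {..<card B} B"
        using ex_bij_betw_nat_finite[OF B(2)] by (auto simp: atLeast0LessThan)
      have "\<exists>k. c = (\<Sum>b\<in>B. vs (k b) b)" if "c \<in> C" for c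
        by (rule vec.finite_basisE[OF B, of c]) (use that vec.basis_subset[OF C(1)] in auto)
      then obtain k where k: "\<And>c. c \<in> C \<Longrightarrow> c = (\<Sum>b\<in>B. vs (k c b) b)" by metis
      obtain y where y: "\<exists>c\<in>C. y c \<noteq> 0" "\<forall>i<card B. (\<Sum>c\<in>C. y c \<odot> k c (g i)) = 0"
        using dependent_of_ore[OF ore C(2) lt, of "\<lambda>c i. k c (g i)"] by blast
      then have "(\<Sum>c\<in>C. y c \<odot> k c b) = 0" if "b \<in> g ` {..<card B}" for b
        using that by auto
      then have y0: "(\<Sum>c\<in>C. y c \<odot> k c b) = 0" if "b \<in> B" for b
        using that bij_betw_imp_surj_on[OF g] by simp
      have "(\<Sum>c\<in>C. vs (y c) c) = (\<Sum>c\<in>C. vs (y c) (\<Sum>b\<in>B. vs (k c b) b))"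
        using k by (intro sum.cong) auto
      also have "\<dots> = (\<Sum>c\<in>C. \<Sum>b\<in>B. vs (y c \<odot> k c b) b)"
        by (simp add: vec.scale_sum_right vec.scale_scale)
      also have "\<dots> = (\<Sum>b\<in>B. vs (\<Sum>c\<in>C. y c \<odot> k c b) b)"
        by (subst sum.swap) (simp add: vec.scale_sum_left)
      also have "\<dots> = 0" using y0 by simp
      finally have "\<forall>c\<in>C. y c = 0"
        using vec.independentD[OF vec.basis_independent[OF C(1)] C(2)] by blast
      then show False using y by blast
    qed
    then show ?thesis using B C finB finC by (meson linorder_neqE_nat)
  qed
qed

text \<open>
  The last coordinate maps \<open>M\<close> onto a left ideal, which is free, and the kernel lies in \<open>\<A>\<^sup>n\<^sup>-\<^sup>1\<close>.
\<close>

lemma submodule_vecs_free: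
  assumes "submodule vs M" "M \<subseteq> vecs n"
  obtains B where "is_basis vs B M"
  using assms
proof (induction n arbitrary: M thesis)
  case 0
  have "M = {0}"
    using 0 vec.submodule_zero[of M] by (auto simp: vecs_def fun_eq_iff)
  then have "is_basis vs {} M"
    by (simp add: is_basis_def mod_independent_def vec.span_explicit)
  then show ?case by (rule 0)
next
  case (Suc n)
  have f: "linear_on vs (\<odot>) M (\<lambda>v. v n)"
    by (rule linear_onI) (simp_all add: vscale_def)
  have "{x\<in>M. x n = 0} \<subseteq> vecs n"
  proof
    fix x assume x: "x \<in> {x\<in>M. x n = 0}"
    have "x i = 0" if "n \<le> i" for i
      using x Suc.prems(3) that by (cases "i = n") (auto simp: vecs_def)
    then show "x \<in> vecs n" by (simp add: vecs_def)
  qed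
  then obtain B where B: "is_basis vs B {x\<in>M. x n = 0}"
    using Suc.IH form.submodule_kernel[OF f Suc.prems(2)] by blast
  obtain E where E: "is_basis (\<odot>) E ((\<lambda>v. v n) ` M)"
    using ideal_basis[OF form.submodule_image[OF f Suc.prems(2)]] .
  show ?case
    using form.basis_of_split_extension[OF f Suc.prems(2) E B] Suc.prems(1) by blast
qed

end

section \<open>The dual as the module of values of linear forms\<close>

lemma sum_fun_apply: "sum f A x = (\<Sum>i\<in>A. f i x)"
  by (induction A rule: infinite_finite_induct) simp_all

lemma sum_nth_distinct: "distinct xs \<Longrightarrow> (\<Sum>v\<in>set xs. f v) = (\<Sum>l<length xs. f (xs ! l))"
  using sum.reindex_bij_betw[OF bij_betw_nth[OF _ refl refl], of xs f] by simp

text \<open>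
  The family \<open>X\<close> consists of the rows of \<open>Q\<close> when \<open>M\<close> is a left module and of its columns when
  \<open>M\<close> is a right module.
\<close>

definition dual :: "('a::ring_1 \<Rightarrow> 'a \<Rightarrow> 'a) \<Rightarrow> (nat \<Rightarrow> nat \<Rightarrow> 'a) \<Rightarrow> (nat \<Rightarrow> 'a) set \<Rightarrow> (nat \<Rightarrow> 'a) set"
  where "dual mul X M = {\<lambda>i. \<phi> (X i) | \<phi>. linear_on (vscale mul) mul M \<phi>}"

text \<open>
  The data from which \<open>M\<^sup>*\<^sup>Q\<close> is usually defined: \<open>gs\<close> is a basis of a finitely generated free factor
  of \<open>M\<close> containing all \<open>X i\<close>, and \<open>Y\<close> the coefficient matrix, stored so that \<open>Y l\<close> collects the
  coefficients of \<open>gs ! l\<close>; thus the \<open>Y l\<close> generate the dual.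
\<close>

definition presents ::
    "('a::ring_1 \<Rightarrow> 'a \<Rightarrow> 'a) \<Rightarrow> nat \<Rightarrow> (nat \<Rightarrow> nat \<Rightarrow> 'a) \<Rightarrow> (nat \<Rightarrow> 'a) set \<Rightarrow>
      (nat \<Rightarrow> 'a) list \<Rightarrow> (nat \<Rightarrow> nat \<Rightarrow> 'a) \<Rightarrow> bool"
  where "presents mul k X M gs Y \<longleftrightarrow>
    (\<exists>L. free_factor (vscale mul) L M \<and> (\<forall>i. X i \<in> L) \<and> is_basis (vscale mul) (set gs) L) \<and>
    distinct gs \<and> (\<forall>l i. length gs \<le> l \<or> k \<le> i \<longrightarrow> Y l i = 0) \<and>
    (\<forall>i. X i = (\<Sum>l<length gs. vscale mul (Y l i) (gs ! l)))"

context left_fir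
begin

lemma dualI:
  assumes "linear_on vs (\<odot>) M \<phi>" "\<And>i. d i = \<phi> (X i)"
  shows "d \<in> dual (\<odot>) X M"
proof -
  have "d = (\<lambda>i. \<phi> (X i))" using assms(2) by (rule ext)
  then show ?thesis using assms(1) unfolding dual_def by auto
qed

lemma dualE:
  assumes "d \<in> dual (\<odot>) X M"
  obtains \<phi> where "linear_on vs (\<odot>) M \<phi>" "d = (\<lambda>i. \<phi> (X i))"
  using assms unfolding dual_def by auto

lemma free_factor_submodule:
  assumes "free_factor vs L M"
  shows "submodule vs L" "L \<subseteq> M"
proof -
  obtain B C where BC: "is_basis vs B L" "B \<subseteq> C" "is_basis vs C M"
    using assms unfolding free_factor_def by blast
  show "submodule vs L" using BC vec.basis_submodule by blast
  show "L \<subseteq> M" using BC vec.basis_span vec.span_mono by metis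
qed

lemma span_rows_subset_iff:
  fixes X :: "nat \<Rightarrow> nat \<Rightarrow> 'a"
  assumes L: "submodule vs L" and X: "\<forall>i\<ge>k. X i = 0"
  shows "mod_span vs (X ` {..<k}) \<subseteq> L \<longleftrightarrow> (\<forall>i. X i \<in> L)"
proof
  assume S: "mod_span vs (X ` {..<k}) \<subseteq> L"
  show "\<forall>i. X i \<in> L"
  proof
    fix i
    show "X i \<in> L"
      using S X vec.submodule_zero[OF L] vec.span_base[of "X i" "X ` {..<k}"]
      by (cases "i < k") auto
  qed
next
  assume "\<forall>i. X i \<in> L"
  then show "mod_span vs (X ` {..<k}) \<subseteq> L" by (intro vec.span_minimal[OF L]) auto
qed

text \<open>
  Relates the rank, a cardinal that refers to an unspecified basis, to any basis at hand.
\<close>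

lemma rk_ordIso_iff:
  assumes B: "is_basis vs B M" and "finite F"
  shows "rk vs M =o |F| \<longleftrightarrow> finite B \<and> card B = card F"
proof -
  define Z where "Z = (SOME B. is_basis vs B M)"
  have Z: "is_basis vs Z M" unfolding Z_def using B by (rule someI)
  have rk: "rk vs M = |Z|" by (simp add: rk_def Z_def)
  show ?thesis
  proof
    assume "rk vs M =o |F|"
    then have "finite Z" "card Z = card F"
      using card_of_ordIso_imp_card[of Z F] assms(2) rk by auto
    then show "finite B \<and> card B = card F" using basis_card_unique[OF Z B] by simp
  next
    assume "finite B \<and> card B = card F"
    then have "finite Z" "card Z = card F" using basis_card_unique[OF B Z] by simp_all
    then have "\<exists>f. bij_betw f Z F" using assms(2) by (simp add: finite_same_card_bij)
    then show "rk vs M =o |F|" using rk card_of_ordIso by metis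
  qed
qed

lemma linear_on_component: "linear_on vs (\<odot>) M (\<lambda>v. v j)"
  by (rule linear_onI) (simp_all add: vscale_def)

text \<open>
  Coordinates are linear forms. Hence the row space of \<open>Q\<close> lies in the dual of a right module, and the
  column space in the dual of a left module.
\<close>

lemma column_in_dual: "(\<lambda>i. X i j) \<in> dual (\<odot>) X M"
  using linear_on_component by (rule dualI) simp

lemma dual_subset_vecs:
  assumes "submodule vs M" "\<forall>i\<ge>k. X i = 0"
  shows "dual (\<odot>) X M \<subseteq> vecs k"
  using assms form.linear_on_zero by (auto simp: dual_def vecs_def)

text \<open>
  Forms on \<open>M\<close> restrict to \<open>L\<close>, and forms on a free factor extend.
\<close>

lemma dual_free_factor:
  assumes "free_factor vs L M" "\<forall>i. X i \<in> L"
  shows "dual (\<odot>) X L = dual (\<odot>) X M"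
proof (intro equalityI subsetI)
  fix d assume "d \<in> dual (\<odot>) X L"
  then obtain \<phi> where \<phi>: "linear_on vs (\<odot>) L \<phi>" "d = (\<lambda>i. \<phi> (X i))" by (rule dualE)
  obtain \<psi> where "linear_on vs (\<odot>) M \<psi>" "\<And>x. x \<in> L \<Longrightarrow> \<psi> x = \<phi> x"
    using form.linear_extension_free_factor[OF assms(1) \<phi>(1)] by blast
  then show "d \<in> dual (\<odot>) X M" using \<phi>(2) assms(2) by (auto intro: dualI)
next
  fix d assume "d \<in> dual (\<odot>) X M"
  then obtain \<phi> where \<phi>: "linear_on vs (\<odot>) M \<phi>" "d = (\<lambda>i. \<phi> (X i))" by (rule dualE)
  then show "d \<in> dual (\<odot>) X L"
    using linear_on_subset[OF \<phi>(1) free_factor_submodule(2)[OF assms(1)]] by (auto intro: dualI)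
qed

lemma presentation_exists:
  assumes M: "submodule vs M" "M \<subseteq> vecs n" and X: "\<forall>i. X i \<in> M" "\<forall>i\<ge>k. X i = 0"
  obtains gs Y where "presents (\<odot>) k X M gs Y"
proof -
  obtain C where C: "is_basis vs C M" using submodule_vecs_free[OF M] .
  have "X ` {..<k} \<subseteq> mod_span vs C" using X vec.basis_span[OF C] by auto
  then obtain T where T: "finite T" "T \<subseteq> C" "X ` {..<k} \<subseteq> mod_span vs T"
    using vec.finite_subset_span[of "X ` {..<k}" C] by auto
  have XT: "X i \<in> mod_span vs T" for i
    using T(3) X(2) vec.submodule_zero[OF vec.submodule_span] by (cases "i < k") auto
  obtain gs where gs: "set gs = T" "distinct gs" using finite_distinct_list[OF T(1)] by blast
  have bT: "is_basis vs T (mod_span vs T)"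
    using vec.independent_mono[OF vec.basis_independent[OF C] T(2)] by (simp add: is_basis_def)
  have "\<forall>i. \<exists>c. X i = (\<Sum>v\<in>T. vs (c v) v)"
    by (rule allI, rule vec.spanE_finite[OF XT T(1)]) blast
  from choice[OF this] obtain c where c: "\<forall>i. X i = (\<Sum>v\<in>T. vs (c i v) v)" ..
  define Y where "Y l i = (if l < length gs \<and> i < k then c i (gs ! l) else 0)" for l i
  have "X i = (\<Sum>l<length gs. vs (Y l i) (gs ! l))" for i
  proof (cases "i < k")
    case True
    have "X i = (\<Sum>l<length gs. vs (c i (gs ! l)) (gs ! l))"
      using c[rule_format, of i] sum_nth_distinct[OF gs(2), of "\<lambda>v. vs (c i v) v"] gs(1) by simp
    then show ?thesis using True by (simp add: Y_def)
  next
    case False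
    then show ?thesis using X(2) by (simp add: Y_def)
  qed
  moreover have "free_factor vs (mod_span vs T) M"
    unfolding free_factor_def using bT T(2) C by blast
  ultimately have "presents (\<odot>) k X M gs Y"
    unfolding presents_def using XT bT gs by (auto simp: Y_def)
  then show thesis by (rule that)
qed

end

text \<open>
  The dual of a left module over \<open>\<odot>\<close> is a left module over the opposite multiplication, so duality
  needs the ideal condition on both sides.
\<close>

locale fir = left_fir mul + op: left_fir "opp mul"
  for mul :: "'a::ring_1 \<Rightarrow> 'a \<Rightarrow> 'a" (infixl "\<odot>" 70)
begin

lemma dual_submodule: "submodule op.vs (dual (\<odot>) X M)"
  unfolding submodule_def
proof (intro conjI ballI allI)
  have "linear_on vs (\<odot>) M (\<lambda>_. 0)" by (rule linear_onI) simp_all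
  then show "0 \<in> dual (\<odot>) X M" by (rule dualI) simp
next
  fix d e assume "d \<in> dual (\<odot>) X M" "e \<in> dual (\<odot>) X M"
  then obtain \<phi> \<psi> where *: "linear_on vs (\<odot>) M \<phi>" "linear_on vs (\<odot>) M \<psi>"
    "d = (\<lambda>i. \<phi> (X i))" "e = (\<lambda>i. \<psi> (X i))" by (blast elim: dualE)
  have "linear_on vs (\<odot>) M (\<lambda>x. \<phi> x + \<psi> x)"
    using *(1,2) by (simp add: linear_on_def mul_add_right)
  then show "d + e \<in> dual (\<odot>) X M" by (rule dualI) (simp add: *(3,4))
next
  fix a d assume "d \<in> dual (\<odot>) X M"
  then obtain \<phi> where *: "linear_on vs (\<odot>) M \<phi>" "d = (\<lambda>i. \<phi> (X i))" by (rule dualE)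
  have "linear_on vs (\<odot>) M (\<lambda>x. \<phi> x \<odot> a)"
    using *(1) by (simp add: linear_on_def mul_add_left mul_assoc)
  then show "op.vs a d \<in> dual (\<odot>) X M" by (rule dualI) (simp add: *(2) vscale_def)
qed

lemma presentsD:
  assumes "presents (\<odot>) k X M gs Y"
  shows "set gs \<subseteq> M" "X i = (\<Sum>l<length gs. vs (Y l i) (gs ! l))"
  using assms free_factor_submodule(2) vec.basis_subset unfolding presents_def by blast+

lemma form_on_presented:
  assumes "presents (\<odot>) k X M gs Y" "submodule vs M" "linear_on vs (\<odot>) M \<phi>"
  shows "\<phi> (X i) = (\<Sum>l<length gs. Y l i \<odot> \<phi> (gs ! l))"
  unfolding presentsD(2)[OF assms(1), of i]
  by (rule form.linear_on_combination[OF assms(3,2)]) (use presentsD(1)[OF assms(1)] in auto)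

text \<open>
  The dual does not depend on the presentation: \<open>Y l\<close> is the value of the coordinate form of \<open>gs ! l\<close>,
  extended from the free factor to \<open>M\<close>, and any form \<open>\<phi>\<close> gives the combination of the \<open>Y l\<close> with
  coefficients \<open>\<phi> (gs ! l)\<close>.
\<close>

lemma span_presentation_eq_dual:
  assumes P: "presents (\<odot>) k X M gs Y" and M: "submodule vs M"
  shows "mod_span op.vs (Y ` {..<length gs}) = dual (\<odot>) X M"
proof (rule op.vec.span_eqI[OF dual_submodule])
  obtain L where L: "free_factor vs L M" "\<And>i. X i \<in> L" "is_basis vs (set gs) L"
    and gs: "distinct gs" using P unfolding presents_def by blast
  show "Y ` {..<length gs} \<subseteq> dual (\<odot>) X M"
  proof safe
    fix l assume l: "l < length gs"
    obtain \<phi> where \<phi>: "linear_on vs (\<odot>) L \<phi>"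
      "\<And>v. v \<in> set gs \<Longrightarrow> \<phi> v = (if v = gs ! l then 1 else 0)"
      using form.linear_extension[OF L(3), of "\<lambda>v. if v = gs ! l then 1 else 0"] by blast
    obtain \<psi> where \<psi>: "linear_on vs (\<odot>) M \<psi>" "\<And>x. x \<in> L \<Longrightarrow> \<psi> x = \<phi> x"
      using form.linear_extension_free_factor[OF L(1) \<phi>(1)] by blast
    have \<psi>_gs: "\<psi> (gs ! l') = (if l' = l then 1 else 0)" if "l' < length gs" for l'
    proof -
      have "gs ! l' \<in> set gs" using that by simp
      then have "\<psi> (gs ! l') = (if gs ! l' = gs ! l then 1 else 0)"
        using \<phi>(2) \<psi>(2) vec.basis_subset[OF L(3)] by auto
      then show ?thesis using nth_eq_iff_index_eq[OF gs that l] by simp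
    qed
    have "\<psi> (X i) = Y l i" for i
    proof -
      have "\<psi> (X i) = (\<Sum>l'<length gs. if l' = l then Y l' i else 0)"
        unfolding form_on_presented[OF P M \<psi>(1)] by (rule sum.cong) (auto simp: \<psi>_gs)
      then show ?thesis using l by simp
    qed
    then show "Y l \<in> dual (\<odot>) X M" by (intro dualI[OF \<psi>(1)]) simp
  qed
  show "dual (\<odot>) X M \<subseteq> mod_span op.vs (Y ` {..<length gs})"
  proof
    fix d assume "d \<in> dual (\<odot>) X M"
    then obtain \<phi> where \<phi>: "linear_on vs (\<odot>) M \<phi>" "d = (\<lambda>i. \<phi> (X i))" by (rule dualE)
    have "d = (\<Sum>l<length gs. op.vs (\<phi> (gs ! l)) (Y l))"
      by (rule ext) (simp add: \<phi>(2) form_on_presented[OF P M \<phi>(1)] sum_fun_apply vscale_def)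
    then show "d \<in> mod_span op.vs (Y ` {..<length gs})"
      by (auto intro: op.vec.combination_in_span)
  qed
qed

lemma presentation_in_dual:
  assumes "presents (\<odot>) k X M gs Y" "submodule vs M" "l \<in> {..<length gs}"
  shows "Y l \<in> dual (\<odot>) X M"
  using op.vec.span_base[of "Y l" "Y ` {..<length gs}"] assms(3)
  by (simp add: span_presentation_eq_dual[OF assms(1,2)])

text \<open>
  The vector that a form on the dual defines is a combination of the basis \<open>gs\<close>; this is why the
  bidual of \<open>M\<close> lies in \<open>M\<close>. It comes from reading \<open>X i = \<Sum>\<^sub>l Y l i \<odot> gs ! l\<close> column by column.
\<close>

lemma bidual_vector:
  assumes P: "presents (\<odot>) k X M gs Y" and M: "submodule vs M"
    and \<psi>: "linear_on op.vs (opp (\<odot>)) (dual (\<odot>) X M) \<psi>"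
  shows "(\<lambda>j. \<psi> (\<lambda>i. X i j)) = (\<Sum>l<length gs. vs (\<psi> (Y l)) (gs ! l))"
proof
  fix j
  note Y = presentation_in_dual[OF P M]
  have "(\<lambda>i. X i j) = (\<Sum>l<length gs. op.vs ((gs ! l) j) (Y l))"
    by (rule ext) (simp add: presentsD(2)[OF P] sum_fun_apply vscale_def)
  then have "\<psi> (\<lambda>i. X i j) = \<psi> (\<Sum>l<length gs. op.vs ((gs ! l) j) (Y l))" by simp
  also have "\<dots> = (\<Sum>l<length gs. \<psi> (Y l) \<odot> (gs ! l) j)"
    by (rule op.form.linear_on_combination[OF \<psi> dual_submodule Y])
  finally show "\<psi> (\<lambda>i. X i j) = (\<Sum>l<length gs. vs (\<psi> (Y l)) (gs ! l)) j"
    by (simp add: sum_fun_apply vscale_def)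
qed

text \<open>
  The matrix pairs forms on \<open>M\<close> with forms on its dual, and the pairing can be evaluated from either
  side: both sides equal \<open>\<Sum>\<^sub>l \<psi> (Y l) \<odot> \<phi> (gs ! l)\<close>.
\<close>

lemma bidual_adjunction:
  assumes P: "presents (\<odot>) k X M gs Y" and M: "submodule vs M"
    and \<phi>: "linear_on vs (\<odot>) M \<phi>"
    and \<psi>: "linear_on op.vs (opp (\<odot>)) (dual (\<odot>) X M) \<psi>"
  shows "\<phi> (\<lambda>j. \<psi> (\<lambda>i. X i j)) = \<psi> (\<lambda>i. \<phi> (X i))"
proof -
  note Y = presentation_in_dual[OF P M]
  have "\<phi> (\<lambda>j. \<psi> (\<lambda>i. X i j)) = (\<Sum>l<length gs. \<psi> (Y l) \<odot> \<phi> (gs ! l))"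
    unfolding bidual_vector[OF P M \<psi>]
    by (rule form.linear_on_combination[OF \<phi> M]) (use presentsD(1)[OF P] in auto)
  also have "\<dots> = \<psi> (\<Sum>l<length gs. op.vs (\<phi> (gs ! l)) (Y l))"
    by (rule op.form.linear_on_combination[OF \<psi> dual_submodule Y, symmetric])
  also have "(\<Sum>l<length gs. op.vs (\<phi> (gs ! l)) (Y l)) = (\<lambda>i. \<phi> (X i))"
    by (rule ext) (simp add: form_on_presented[OF P M \<phi>] sum_fun_apply vscale_def)
  finally show ?thesis .
qed

abbreviation "bidual X M \<equiv> dual (opp (\<odot>)) (\<lambda>j i. X i j) (dual (\<odot>) X M)"

end

section \<open>The bidual is a direct summand\<close>

context fir
begin

text \<open>
  The forms \<open>\<phi> e\<close> that represent a basis \<open>E\<close> of the dual and the vectors \<open>c e\<close> of the bidual given by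
  the coordinate forms of \<open>E\<close> are biorthogonal, by the adjunction. So \<open>c ` E\<close> is a basis of the bidual,
  and \<open>M\<close> projects onto the bidual along the common kernel of the \<open>\<phi> e\<close>, with basis \<open>B\<close>.
\<close>

lemma bidual_decomposition:
  assumes M: "submodule vs M" "M \<subseteq> vecs n" and X: "\<forall>i. X i \<in> M" "\<forall>i\<ge>k. X i = 0"
  obtains E c B where "finite E" "is_basis op.vs E (dual (\<odot>) X M)"
    "inj_on c E" "is_basis vs (c ` E) (bidual X M)"
    "c ` E \<inter> B = {}" "is_basis vs (c ` E \<union> B) M"
    "bidual X M \<subseteq> M" "\<forall>i. X i \<in> bidual X M"
proof -
  let ?D = "dual (\<odot>) X M" and ?DD = "bidual X M"
  obtain gs Y where P: "presents (\<odot>) k X M gs Y" using presentation_exists[OF M X] by blast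
  have D: "submodule op.vs ?D" "?D \<subseteq> vecs k"
    using dual_submodule dual_subset_vecs[OF M(1) X(2)] by auto
  obtain E where E: "is_basis op.vs E ?D" using op.submodule_vecs_free[OF D] .
  have finE: "finite E"
    by (rule op.vec.finitely_generated_basis_finite[OF E, of "Y ` {..<length gs}"])
      (simp_all add: span_presentation_eq_dual[OF P M(1)])
  have "\<forall>e\<in>E. \<exists>\<phi>. linear_on vs (\<odot>) M \<phi> \<and> e = (\<lambda>i. \<phi> (X i))"
    using op.vec.basis_subset[OF E] by (blast elim: dualE)
  from bchoice[OF this] obtain \<phi>
    where \<phi>': "\<forall>e\<in>E. linear_on vs (\<odot>) M (\<phi> e) \<and> e = (\<lambda>i. \<phi> e (X i))" ..
  have \<phi>: "linear_on vs (\<odot>) M (\<phi> e)" "(\<lambda>i. \<phi> e (X i)) = e" if "e \<in> E" for e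
    using conjunct1[OF bspec[OF \<phi>' that]] conjunct2[OF bspec[OF \<phi>' that], symmetric] .
  have "\<forall>e. \<exists>\<psi>. linear_on op.vs (opp (\<odot>)) ?D \<psi> \<and> (\<forall>e'\<in>E. \<psi> e' = (if e' = e then 1 else 0))"
  proof
    fix e
    obtain \<psi> where "linear_on op.vs (opp (\<odot>)) ?D \<psi>" "\<And>b. b \<in> E \<Longrightarrow> \<psi> b = (if b = e then 1 else 0)"
      using op.form.linear_extension[OF E, of "\<lambda>b. if b = e then 1 else 0"] by blast
    then show "\<exists>\<psi>. linear_on op.vs (opp (\<odot>)) ?D \<psi> \<and> (\<forall>e'\<in>E. \<psi> e' = (if e' = e then 1 else 0))"
      by (intro exI[of _ \<psi>]) simp
  qed
  from choice[OF this] obtain \<psi> where \<psi>':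
    "\<forall>e. linear_on op.vs (opp (\<odot>)) ?D (\<psi> e) \<and> (\<forall>e'\<in>E. \<psi> e e' = (if e' = e then 1 else 0))" ..
  then have \<psi>: "linear_on op.vs (opp (\<odot>)) ?D (\<psi> e)"
    "e' \<in> E \<Longrightarrow> \<psi> e e' = (if e' = e then 1 else 0)" for e e'
    by blast+
  define c where "c e = (\<lambda>j. \<psi> e (\<lambda>i. X i j))" for e
  have DD_sub: "submodule vs ?DD"
  proof -
    \<comment> \<open>Bidual and dual exchange roles over the opposite multiplication, whose opposite is again \<open>\<odot>\<close>.\<close>
    interpret opop: fir "opp (\<odot>)"
      by unfold_locales (simp_all add: ideal_free)
    show ?thesis by (rule opop.dual_submodule)
  qed
  have in_M: "d \<in> M" if "d \<in> ?DD" for d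
  proof -
    obtain \<xi> where \<xi>: "linear_on op.vs (opp (\<odot>)) ?D \<xi>" "d = (\<lambda>j. \<xi> (\<lambda>i. X i j))"
      by (rule op.dualE[OF \<open>d \<in> ?DD\<close>])
    have "set gs \<subseteq> M" using presentsD(1)[OF P] .
    then show ?thesis unfolding \<xi>(2) bidual_vector[OF P M(1) \<xi>(1)]
      by (intro vec.submodule_sum[OF M(1)] vec.submodule_scale[OF M(1)]) auto
  qed
  have c_DD: "c e \<in> ?DD" for e
    unfolding c_def using \<psi>(1) by (rule op.dualI) simp
  have c_M: "c e \<in> M" for e using c_DD in_M by blast
  have \<phi>_c: "\<phi> e (c e') = (if e = e' then 1 else 0)" if "e \<in> E" for e e'
    unfolding c_def bidual_adjunction[OF P M(1) \<phi>(1)[OF that] \<psi>(1)] \<phi>(2)[OF that]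
    using \<psi>(2) that by simp
  have inj: "inj_on c E"
  proof (rule inj_onI)
    fix e e' assume "e \<in> E" "e' \<in> E" "c e = c e'"
    then show "e = e'" using \<phi>_c[of e e] \<phi>_c[of e e'] by (auto split: if_splits)
  qed
  have \<phi>_sum: "\<phi> e (\<Sum>e'\<in>T. vs (a e') (c e')) = a e" if "e \<in> T" "T \<subseteq> E" "finite T" for e T a
  proof -
    have "\<phi> e (\<Sum>e'\<in>T. vs (a e') (c e')) = (\<Sum>e'\<in>T. a e' \<odot> \<phi> e (c e'))"
      by (rule form.linear_on_combination[OF \<phi>(1) M(1)]) (use that c_M in auto)
    also have "\<dots> = (\<Sum>e'\<in>T. if e' = e then a e' else 0)"
      by (rule sum.cong) (use that in \<open>auto simp: \<phi>_c\<close>)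
    finally show ?thesis using that by simp
  qed
  have indep: "mod_independent vs (c ` E)"
    unfolding mod_independent_def
  proof (intro allI impI ballI; elim conjE)
    fix T a v assume T: "finite T" "T \<subseteq> c ` E" "(\<Sum>v\<in>T. vs (a v) v) = 0" and v: "v \<in> T"
    obtain U where U: "finite U" "U \<subseteq> E" "T = c ` U" using T finite_subset_image by meson
    have "(\<Sum>v\<in>T. vs (a v) v) = (\<Sum>e\<in>U. vs (a (c e)) (c e))"
      unfolding U(3) by (rule sum.reindex[OF inj_on_subset[OF inj U(2)], unfolded o_def])
    then have zero: "(\<Sum>e\<in>U. vs (a (c e)) (c e)) = 0" using T by simp
    obtain e where e: "e \<in> U" "v = c e" using v U by blast
    have "a (c e) = \<phi> e 0" using \<phi>_sum[of e U "\<lambda>e. a (c e)"] e U zero by simp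
    also have "\<dots> = 0" using form.linear_on_zero[OF \<phi>(1) M(1)] e U by blast
    finally show "a v = 0" using e by simp
  qed
  have span: "mod_span vs (c ` E) = ?DD"
  proof (rule vec.span_eqI[OF DD_sub])
    show "c ` E \<subseteq> ?DD" using c_DD by blast
    show "?DD \<subseteq> mod_span vs (c ` E)"
    proof
      fix d assume "d \<in> ?DD"
      then obtain \<xi> where \<xi>: "linear_on op.vs (opp (\<odot>)) ?D \<xi>" "d = (\<lambda>j. \<xi> (\<lambda>i. X i j))"
        by (rule op.dualE)
      \<comment> \<open>Every form on the dual is a combination of the coordinate forms; here it is expanded in them.\<close>
      have "linear_on op.vs (opp (\<odot>)) ?D (\<lambda>x. \<Sum>e\<in>E. \<xi> e \<odot> \<psi> e x)"
        using \<psi>(1) unfolding linear_on_def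
        by (simp add: mul_add_right sum.distrib mul_assoc ideal.scale_sum_left)
      moreover have "\<xi> b = (\<Sum>e\<in>E. \<xi> e \<odot> \<psi> e b)" if "b \<in> E" for b
      proof -
        have "(\<Sum>e\<in>E. \<xi> e \<odot> \<psi> e b) = (\<Sum>e\<in>E. if e = b then \<xi> e else 0)"
          by (rule sum.cong) (use that in \<open>auto simp: \<psi>(2)\<close>)
        then show ?thesis using that finE by simp
      qed
      ultimately have "\<xi> x = (\<Sum>e\<in>E. \<xi> e \<odot> \<psi> e x)" if "x \<in> ?D" for x
        using op.form.linear_on_eqI[OF \<xi>(1) _ op.vec.basis_span[OF E, symmetric]] that by blast
      then have "d = (\<Sum>e\<in>E. vs (\<xi> e) (c e))"
        using column_in_dual[of X _ M] by (auto simp: \<xi>(2) c_def sum_fun_apply vscale_def fun_eq_iff)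
      then show "d \<in> mod_span vs (c ` E)" by (auto intro: vec.combination_in_span)
    qed
  qed
  have bDD: "is_basis vs (c ` E) ?DD" using indep span by (simp add: is_basis_def)
  define \<pi> where "\<pi> x = (\<Sum>e\<in>E. vs (\<phi> e x) (c e))" for x
  have \<pi>: "linear_on vs vs M \<pi>"
  proof (rule linear_onI)
    fix x y assume "x \<in> M" "y \<in> M"
    then have "\<phi> e (x + y) = \<phi> e x + \<phi> e y" if "e \<in> E" for e
      using form.linear_on_add[OF \<phi>(1)[OF that]] by blast
    then show "\<pi> (x + y) = \<pi> x + \<pi> y"
      unfolding \<pi>_def by (simp add: vec.scale_add_left sum.distrib)
  next
    fix a x assume "x \<in> M"
    then have "\<phi> e (vs a x) = a \<odot> \<phi> e x" if "e \<in> E" for e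
      using form.linear_on_scale[OF \<phi>(1)[OF that]] by blast
    then show "\<pi> (vs a x) = vs a (\<pi> x)"
      unfolding \<pi>_def by (simp add: vec.scale_sum_right vec.scale_scale)
  qed
  interpret self: module_pair "(\<odot>)" vs vs by unfold_locales
  have \<pi>_DD: "\<pi> x \<in> ?DD" for x
    unfolding \<pi>_def span[symmetric] by (rule vec.combination_in_span) simp
  have \<pi>_id: "\<pi> x = x" if "x \<in> ?DD" for x
  proof -
    have "x \<in> mod_span vs (c ` E)" using that span by simp
    then obtain a where "x = (\<Sum>v\<in>c ` E. vs (a v) v)"
      by (rule vec.spanE_finite) (use finE in simp)
    then have x: "x = (\<Sum>e\<in>E. vs (a (c e)) (c e))"
      using sum.reindex[OF inj, of "\<lambda>v. vs (a v) v"] by (simp add: o_def)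
    have "\<phi> e x = a (c e)" if "e \<in> E" for e
      unfolding x by (rule \<phi>_sum) (use that finE in auto)
    then show ?thesis unfolding \<pi>_def by (subst (2) x) (rule sum.cong, auto)
  qed
  let ?K = "{x\<in>M. \<pi> x = 0}"
  have "?K \<subseteq> vecs n" using M by auto
  then obtain B where B: "is_basis vs B ?K"
    by (rule submodule_vecs_free[OF self.submodule_kernel[OF \<pi> M(1)]])
  have "?DD \<inter> ?K \<subseteq> {0}" using \<pi>_id by force
  moreover have "M = {x + y | x y. x \<in> ?DD \<and> y \<in> ?K}"
  proof (intro equalityI subsetI)
    fix x assume x: "x \<in> M"
    have "\<pi> (x - \<pi> x) = 0"
      using self.linear_on_diff[OF \<pi> M(1) x in_M[OF \<pi>_DD]] \<pi>_id[OF \<pi>_DD] by simp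
    then have "x - \<pi> x \<in> ?K" using x in_M[OF \<pi>_DD] vec.submodule_diff[OF M(1)] by simp
    then show "x \<in> {x + y | x y. x \<in> ?DD \<and> y \<in> ?K}"
      using \<pi>_DD[of x] by (intro CollectI exI[of _ "\<pi> x"] exI[of _ "x - \<pi> x"]) simp
  next
    fix x assume "x \<in> {x + y | x y. x \<in> ?DD \<and> y \<in> ?K}"
    then show "x \<in> M" using in_M vec.submodule_add[OF M(1)] by blast
  qed
  ultimately have "is_basis vs (c ` E \<union> B) M" "c ` E \<inter> B = {}"
    by (rule vec.basis_direct_sum[OF bDD B])+
  moreover have "X i \<in> ?DD" for i
    by (rule op.dualI[OF op.linear_on_component[of _ i]]) simp
  ultimately show thesis
    using that[OF finE E inj bDD] in_M by blast
qed

text \<open>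
  The factor has the same dual as \<open>M\<close>, hence the same bidual, which lies in the factor. So the bidual
  is the least free factor of \<open>M\<close> containing the given vectors.
\<close>

lemma bidual_subset_free_factor:
  assumes M: "submodule vs M" "M \<subseteq> vecs n" and L: "free_factor vs L M"
    and X: "\<forall>i. X i \<in> L" "\<forall>i\<ge>k. X i = 0"
  shows "bidual X M \<subseteq> L"
proof -
  have "submodule vs L" "L \<subseteq> vecs n" using free_factor_submodule[OF L] M by auto
  then have "bidual X L \<subseteq> L" using bidual_decomposition[OF _ _ X] by metis
  then show ?thesis using dual_free_factor[OF L X(1)] by simp
qed

text \<open>
  With a basis \<open>c ` E \<union> B\<close> of \<open>M\<close> as in the decomposition, each condition means that \<open>B\<close> is empty. For
  the ranks this uses that \<open>E\<close> is finite.
\<close>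

lemma bidual_equivalences:
  assumes M: "submodule vs M" "M \<subseteq> vecs n" and X: "\<forall>i. X i \<in> M" "\<forall>i\<ge>k. X i = 0"
  shows "algebraic_ext vs (mod_span vs (X ` {..<k})) M \<longleftrightarrow> bidual X M = M"
    and "bidual X M = M \<longleftrightarrow> rk op.vs (dual (\<odot>) X M) =o rk vs M"
proof -
  let ?S = "mod_span vs (X ` {..<k})"
  obtain E c B where E: "finite E" "is_basis op.vs E (dual (\<odot>) X M)"
    and c: "inj_on c E" "is_basis vs (c ` E) (bidual X M)"
    and B: "c ` E \<inter> B = {}" "is_basis vs (c ` E \<union> B) M"
    and DD: "bidual X M \<subseteq> M" "\<forall>i. X i \<in> bidual X M"
    using bidual_decomposition[OF M X] .
  have S_sub: "?S \<subseteq> L \<longleftrightarrow> (\<forall>i. X i \<in> L)" if "submodule vs L" for L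
    using that X(2) by (rule span_rows_subset_iff)
  show "algebraic_ext vs ?S M \<longleftrightarrow> bidual X M = M"
  proof
    assume alg: "algebraic_ext vs ?S M"
    have "free_factor vs (bidual X M) M"
      unfolding free_factor_def using c(2) B(2) by blast
    moreover have "?S \<subseteq> bidual X M"
      using S_sub[OF vec.basis_submodule[OF c(2)]] DD(2) by blast
    ultimately show "bidual X M = M"
      using alg DD(1) unfolding algebraic_ext_def by blast
  next
    assume eq: "bidual X M = M"
    have "M \<subseteq> L" if L: "free_factor vs L M" "?S \<subseteq> L" for L
      using bidual_subset_free_factor[OF M L(1) _ X(2)] S_sub[OF free_factor_submodule(1)[OF L(1)]] L(2) eq
      by simp
    moreover have "?S \<subseteq> M" using S_sub[OF M(1)] X(1) by simp
    ultimately show "algebraic_ext vs ?S M" unfolding algebraic_ext_def by blast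
  qed
  have rkD: "rk op.vs (dual (\<odot>) X M) =o |E|"
    using op.rk_ordIso_iff[OF E(2,1)] E(1) by simp
  have "rk op.vs (dual (\<odot>) X M) =o rk vs M \<longleftrightarrow> rk vs M =o |E|"
    using rkD ordIso_symmetric ordIso_transitive by blast
  also have "\<dots> \<longleftrightarrow> finite (c ` E \<union> B) \<and> card (c ` E \<union> B) = card E"
    by (rule rk_ordIso_iff[OF B(2) E(1)])
  also have "\<dots> \<longleftrightarrow> B = {}"
    using E(1) B(1) by (auto simp: card_Un_disjoint card_image[OF c(1)])
  also have "\<dots> \<longleftrightarrow> bidual X M = M"
  proof
    assume "B = {}"
    then show "bidual X M = M" using vec.basis_span[OF c(2)] vec.basis_span[OF B(2)] by simp
  next
    assume eq: "bidual X M = M"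
    show "B = {}"
    proof (rule equals0I)
      fix b assume b: "b \<in> B"
      then have "b \<notin> mod_span vs (c ` E)"
        using vec.independent_span_notin[OF vec.basis_independent[OF B(2)]] B(1) by blast
      moreover have "b \<in> M" using b vec.basis_subset[OF B(2)] by blast
      ultimately show False using vec.basis_span[OF c(2)] eq by simp
    qed
  qed
  finally show "bidual X M = M \<longleftrightarrow> rk op.vs (dual (\<odot>) X M) =o rk vs M" by blast
qed

end

section \<open>Row and column spaces of a matrix\<close>

text \<open>
  Existence and uniqueness of the module that the choice operator selects in the matrix definitions
  of the two duals.
\<close>

lemma (in fir) presented_span_iff_dual:
  assumes M: "submodule vs M" "M \<subseteq> vecs n" and X: "\<forall>i. X i \<in> M" "\<forall>i\<ge>k. X i = 0"
  shows "(\<exists>gs Y. presents (\<odot>) k X M gs Y \<and> D = mod_span op.vs (Y ` {..<length gs})) \<longleftrightarrow>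
    D = dual (\<odot>) X M"
proof -
  obtain gs Y where P: "presents (\<odot>) k X M gs Y" using presentation_exists[OF M X] .
  show ?thesis
    using P span_presentation_eq_dual[OF _ M(1)] by metis
qed

lemma free_ideal_ring_fir:
  assumes "free_ideal_ring TYPE('a::ring_1)"
  shows "fir ((*) :: 'a \<Rightarrow> 'a \<Rightarrow> 'a)" "fir (\<lambda>a b :: 'a. b * a)"
  using assms unfolding free_ideal_ring_def
  by (unfold_locales; simp add: algebra_simps)+

lemma lscale_eq_vscale: "lscale = vscale (*)"
  and rscale_eq_vscale: "rscale = vscale (\<lambda>a b. b * a)"
  by (simp_all add: fun_eq_iff lscale_def rscale_def vscale_def)

lemma row_space_subset_iff:
  fixes Q :: "nat \<Rightarrow> nat \<Rightarrow> 'a::ring_1"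
  assumes "fir ((*) :: 'a \<Rightarrow> 'a \<Rightarrow> 'a)" "Q \<in> mats k m" "submodule lscale L"
  shows "row_space k Q \<subseteq> L \<longleftrightarrow> (\<forall>i. Q i \<in> L)"
proof -
  interpret fir "(*) :: 'a \<Rightarrow> 'a \<Rightarrow> 'a" by fact
  have "\<forall>i\<ge>k. Q i = 0" using assms(2) by (simp add: mats_def fun_eq_iff)
  then show ?thesis
    using span_rows_subset_iff assms(3) unfolding row_space_def lscale_eq_vscale by blast
qed

lemma col_space_subset_iff:
  fixes Q :: "nat \<Rightarrow> nat \<Rightarrow> 'a::ring_1"
  assumes "fir (\<lambda>a b :: 'a. b * a)" "Q \<in> mats k m" "submodule rscale L"
  shows "col_space m Q \<subseteq> L \<longleftrightarrow> (\<forall>j. (\<lambda>i. Q i j) \<in> L)"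
proof -
  interpret fir "\<lambda>a b :: 'a. b * a" by fact
  have "\<forall>j\<ge>m. (\<lambda>i. Q i j) = 0" using assms(2) by (simp add: mats_def fun_eq_iff)
  then show ?thesis
    using span_rows_subset_iff[of L m "\<lambda>j i. Q i j"] assms(3)
    unfolding col_space_def rscale_eq_vscale by blast
qed

lemma left_dual_eq_dual:
  fixes Q :: "nat \<Rightarrow> nat \<Rightarrow> 'a::ring_1"
  assumes fir: "fir ((*) :: 'a \<Rightarrow> 'a \<Rightarrow> 'a)" and Q: "Q \<in> mats k m"
    and M: "submodule lscale M" "M \<subseteq> vecs m" and QM: "\<forall>i. Q i \<in> M"
  shows "left_dual k Q M = dual (*) Q M"
proof -
  interpret fir "(*) :: 'a \<Rightarrow> 'a \<Rightarrow> 'a" by fact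
  have Q0: "\<forall>i\<ge>k. Q i = 0" using Q by (simp add: mats_def fun_eq_iff)
  have step: "free_factor lscale L M \<and> row_space k Q \<subseteq> L \<and> distinct gs \<and> is_basis lscale (set gs) L \<and>
      C \<in> mats k (length gs) \<and> Q = mat_mul (length gs) C (\<lambda>l. gs ! l) \<longleftrightarrow>
      (free_factor lscale L M \<and> (\<forall>i. Q i \<in> L) \<and> is_basis lscale (set gs) L) \<and> distinct gs \<and>
      (\<forall>l i. length gs \<le> l \<or> k \<le> i \<longrightarrow> C i l = 0) \<and>
      (\<forall>i. Q i = (\<Sum>l<length gs. lscale (C i l) (gs ! l)))" for L gs C
  proof -
    have "row_space k Q \<subseteq> L \<longleftrightarrow> (\<forall>i. Q i \<in> L)" if "is_basis lscale (set gs) L"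
      using row_space_subset_iff[OF fir Q] vec.basis_submodule that unfolding lscale_eq_vscale by blast
    moreover have "C \<in> mats k (length gs) \<longleftrightarrow> (\<forall>l i. length gs \<le> l \<or> k \<le> i \<longrightarrow> C i l = 0)"
      by (auto simp: mats_def)
    moreover have "Q = mat_mul (length gs) C (\<lambda>l. gs ! l) \<longleftrightarrow>
        (\<forall>i. Q i = (\<Sum>l<length gs. lscale (C i l) (gs ! l)))"
      by (simp add: fun_eq_iff mat_mul_def sum_fun_apply lscale_def)
    ultimately show ?thesis by blast
  qed
  have presents_iff: "presents (*) k Q M gs (\<lambda>l i. C i l) \<longleftrightarrow>
      (\<exists>L. free_factor lscale L M \<and> row_space k Q \<subseteq> L \<and> distinct gs \<and>
      is_basis lscale (set gs) L \<and> C \<in> mats k (length gs) \<and>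
      Q = mat_mul (length gs) C (\<lambda>l. gs ! l))" for gs C
    unfolding step unfolding presents_def lscale_eq_vscale by blast
  have "(\<exists>L gs C. free_factor lscale L M \<and> row_space k Q \<subseteq> L \<and> distinct gs \<and>
      is_basis lscale (set gs) L \<and> C \<in> mats k (length gs) \<and>
      Q = mat_mul (length gs) C (\<lambda>l. gs ! l) \<and> D = col_space (length gs) C) \<longleftrightarrow>
      (\<exists>gs Y. presents (*) k Q M gs Y \<and> D = mod_span rscale (Y ` {..<length gs}))" (is "?A \<longleftrightarrow> ?B") for D
  proof
    assume ?A
    then obtain gs C where "presents (*) k Q M gs (\<lambda>l i. C i l)" "D = col_space (length gs) C"
      unfolding presents_iff by blast
    then show ?B unfolding col_space_def by blast
  next
    assume ?B
    then obtain gs Y where "presents (*) k Q M gs Y" "D = col_space (length gs) (\<lambda>i l. Y l i)"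
      unfolding col_space_def by blast
    then show ?A using presents_iff[of gs "\<lambda>i l. Y l i"] by blast
  qed
  then show ?thesis
    using presented_span_iff_dual[OF M(1)[unfolded lscale_eq_vscale] M(2) QM Q0]
    unfolding left_dual_def rscale_eq_vscale by simp
qed

lemma right_dual_eq_dual:
  fixes Q :: "nat \<Rightarrow> nat \<Rightarrow> 'a::ring_1"
  assumes fir: "fir (\<lambda>a b :: 'a. b * a)" and Q: "Q \<in> mats k m"
    and M: "submodule rscale M" "M \<subseteq> vecs k" and QM: "\<forall>j. (\<lambda>i. Q i j) \<in> M"
  shows "right_dual m Q M = dual (\<lambda>a b. b * a) (\<lambda>j i. Q i j) M"
proof -
  interpret fir "\<lambda>a b :: 'a. b * a" by fact
  have Q0: "\<forall>j\<ge>m. (\<lambda>i. Q i j) = 0" using Q by (simp add: mats_def fun_eq_iff)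
  have step: "free_factor rscale L M \<and> col_space m Q \<subseteq> L \<and> distinct fs \<and> is_basis rscale (set fs) L \<and>
      B \<in> mats (length fs) m \<and> Q = mat_mul (length fs) (\<lambda>i l. (fs ! l) i) B \<longleftrightarrow>
      (free_factor rscale L M \<and> (\<forall>j. (\<lambda>i. Q i j) \<in> L) \<and> is_basis rscale (set fs) L) \<and> distinct fs \<and>
      (\<forall>l j. length fs \<le> l \<or> m \<le> j \<longrightarrow> B l j = 0) \<and>
      (\<forall>j. (\<lambda>i. Q i j) = (\<Sum>l<length fs. rscale (B l j) (fs ! l)))" for L fs B
  proof -
    have "col_space m Q \<subseteq> L \<longleftrightarrow> (\<forall>j. (\<lambda>i. Q i j) \<in> L)" if "is_basis rscale (set fs) L"
      using col_space_subset_iff[OF fir Q] vec.basis_submodule that unfolding rscale_eq_vscale by blast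
    moreover have "B \<in> mats (length fs) m \<longleftrightarrow> (\<forall>l j. length fs \<le> l \<or> m \<le> j \<longrightarrow> B l j = 0)"
      by (auto simp: mats_def)
    moreover have "Q = mat_mul (length fs) (\<lambda>i l. (fs ! l) i) B \<longleftrightarrow>
        (\<forall>j. (\<lambda>i. Q i j) = (\<Sum>l<length fs. rscale (B l j) (fs ! l)))"
      by (auto simp: fun_eq_iff mat_mul_def sum_fun_apply rscale_def)
    ultimately show ?thesis by blast
  qed
  have presents_iff: "presents (\<lambda>a b. b * a) m (\<lambda>j i. Q i j) M fs B \<longleftrightarrow>
      (\<exists>L. free_factor rscale L M \<and> col_space m Q \<subseteq> L \<and> distinct fs \<and>
      is_basis rscale (set fs) L \<and> B \<in> mats (length fs) m \<and>
      Q = mat_mul (length fs) (\<lambda>i l. (fs ! l) i) B)" for fs B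
    unfolding step unfolding presents_def rscale_eq_vscale by blast
  have "(\<exists>L fs B. free_factor rscale L M \<and> col_space m Q \<subseteq> L \<and> distinct fs \<and>
      is_basis rscale (set fs) L \<and> B \<in> mats (length fs) m \<and>
      Q = mat_mul (length fs) (\<lambda>i l. (fs ! l) i) B \<and> D = row_space (length fs) B) \<longleftrightarrow>
      (\<exists>fs B. presents (\<lambda>a b. b * a) m (\<lambda>j i. Q i j) M fs B \<and>
        D = mod_span lscale (B ` {..<length fs}))" for D
    unfolding presents_iff row_space_def by blast
  then show ?thesis
    using presented_span_iff_dual[OF M(1)[unfolded rscale_eq_vscale] M(2) QM Q0]
    unfolding right_dual_def lscale_eq_vscale by simp
qed

theorem theorem1p4:
  fixes Q :: "nat \<Rightarrow> nat \<Rightarrow> 'a::ring_1" and k m :: nat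
  assumes "free_ideal_ring TYPE('a)" and "Q \<in> mats k m"
  shows
    "(\<forall>M. submodule lscale M \<and> row_space k Q \<subseteq> M \<and> M \<subseteq> vecs m \<longrightarrow>
        (algebraic_ext lscale (row_space k Q) M \<longleftrightarrow> right_dual m Q (left_dual k Q M) = M) \<and>
        (right_dual m Q (left_dual k Q M) = M \<longleftrightarrow> rk rscale (left_dual k Q M) =o rk lscale M)) \<and>
     (\<forall>M. submodule rscale M \<and> col_space m Q \<subseteq> M \<and> M \<subseteq> vecs k \<longrightarrow>
        (algebraic_ext rscale (col_space m Q) M \<longleftrightarrow> left_dual k Q (right_dual m Q M) = M) \<and>
        (left_dual k Q (right_dual m Q M) = M \<longleftrightarrow> rk lscale (right_dual m Q M) =o rk rscale M))"
proof -
  note fir = free_ideal_ring_fir[OF assms(1)]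
  interpret L: fir "(*) :: 'a \<Rightarrow> 'a \<Rightarrow> 'a" by (rule fir)
  interpret R: fir "\<lambda>a b :: 'a. b * a" by (rule fir)
  let ?QT = "\<lambda>j i. Q i j"
  have Q0: "\<forall>i\<ge>k. Q i = 0" "\<forall>j\<ge>m. ?QT j = 0"
    using assms(2) by (simp_all add: mats_def fun_eq_iff)
  show ?thesis
  proof (intro conjI[of "\<forall>M. _ M"] allI impI; elim conjE)
    fix M :: "(nat \<Rightarrow> 'a) set"
    assume M: "submodule lscale M" "row_space k Q \<subseteq> M" "M \<subseteq> vecs m"
    have QM: "\<forall>i. Q i \<in> M" using row_space_subset_iff[OF fir(1) assms(2) M(1)] M(2) by blast
    have D: "left_dual k Q M = dual (*) Q M"
      using left_dual_eq_dual[OF fir(1) assms(2) M(1,3) QM] .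
    have "submodule rscale (dual (*) Q M)"
      unfolding rscale_eq_vscale by (rule L.dual_submodule)
    moreover have "dual (*) Q M \<subseteq> vecs k"
      by (rule L.dual_subset_vecs[OF M(1)[unfolded lscale_eq_vscale] Q0(1)])
    moreover have "\<forall>j. ?QT j \<in> dual (*) Q M" using L.column_in_dual by blast
    ultimately have DD: "right_dual m Q (dual (*) Q M) = L.bidual Q M"
      by (rule right_dual_eq_dual[OF fir(2) assms(2)])
    show "(algebraic_ext lscale (row_space k Q) M \<longleftrightarrow> right_dual m Q (left_dual k Q M) = M) \<and>
        (right_dual m Q (left_dual k Q M) = M \<longleftrightarrow> rk rscale (left_dual k Q M) =o rk lscale M)"
      unfolding D DD row_space_def lscale_eq_vscale rscale_eq_vscale
      by (intro conjI L.bidual_equivalences[OF M(1)[unfolded lscale_eq_vscale] M(3) QM Q0(1)])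
  next
    fix M :: "(nat \<Rightarrow> 'a) set"
    assume M: "submodule rscale M" "col_space m Q \<subseteq> M" "M \<subseteq> vecs k"
    have QM: "\<forall>j. ?QT j \<in> M" using col_space_subset_iff[OF fir(2) assms(2) M(1)] M(2) by blast
    have D: "right_dual m Q M = dual (\<lambda>a b. b * a) ?QT M"
      using right_dual_eq_dual[OF fir(2) assms(2) M(1,3) QM] .
    have "submodule lscale (dual (\<lambda>a b. b * a) ?QT M)"
      unfolding lscale_eq_vscale by (rule R.dual_submodule)
    moreover have "dual (\<lambda>a b. b * a) ?QT M \<subseteq> vecs m"
      by (rule L.op.dual_subset_vecs[OF M(1)[unfolded rscale_eq_vscale] Q0(2)])
    moreover have "\<forall>i. Q i \<in> dual (\<lambda>a b. b * a) ?QT M" using L.op.column_in_dual[where X = ?QT] by simp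
    ultimately have DD: "left_dual k Q (dual (\<lambda>a b. b * a) ?QT M) = R.bidual ?QT M"
      by (rule left_dual_eq_dual[OF fir(1) assms(2)])
    show "(algebraic_ext rscale (col_space m Q) M \<longleftrightarrow> left_dual k Q (right_dual m Q M) = M) \<and>
        (left_dual k Q (right_dual m Q M) = M \<longleftrightarrow> rk lscale (right_dual m Q M) =o rk rscale M)"
      unfolding D DD col_space_def lscale_eq_vscale rscale_eq_vscale
      by (intro conjI R.bidual_equivalences[OF M(1)[unfolded rscale_eq_vscale] M(3) QM Q0(2)])
  qed
qed

end
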